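(* Let $G$ be a subgroup of $\mathrm{GL}(d,\mathbb{R})$ and let $V$ be a finite-dimensional vector subspace of $X_d$. Suppose that there is $z_0\in\mathbb{R}^d$ such that $\Lambda_{G,z_0}$ has nonempty interior in $\mathbb{R}^d$, that $\tau_h(V)\subseteq V$ for all $h\in\mathbb{R}^d$, and that $O_P(V)\subseteq V$ for all $P\in G$. Then every element of $V$ is an ordinary polynomial in $d$ real variables.
   Context: $X_d$ denotes either $C(\mathbb{R}^d)$ (real-valued continuous functions) or $\mathcal{D}(\mathbb{R}^d)'$ (real-valued Schwartz distributions). For $g\in C(\mathbb{R}^d)$, $h\in\mathbb{R}^d$, $P\in\mathrm{GL}(d,\mathbb{R})$: $\tau_hg(x)=g(x+h)$ and $O_Pg(x)=g(Px)$. For $f\in\mathcal{D}(\mathbb{R}^d)'$ and a test function $\phi$: $\tau_h(f)\{\phi\}=f\{\phi(\cdot-h)\}$ and $O_P(f)\{\phi\}=\frac{1}{|\det P|}f\{\phi(P^{-1}\cdot)\}$. For a subgroup $G\subseteq\mathrm{GL}(d,\mathbb{R})$ and $z_0\in\mathbb{R}^d$, $\Lambda_{G,z_0}=\{Pz_0-Qz_0: P,Q\in G\}$. A distribution is an ordinary polynomial if it coincides, as a distribution, with an element of $\mathbb{R}[x_1,\dots,x_d]$ (for continuous functions this means equality everywhere). *)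

theory Defs
  imports "HOL-Analysis.Analysis"
begin

definition subgroup_GL :: "(real^'n^'n) set \<Rightarrow> bool" where
  "subgroup_GL G \<longleftrightarrow> G \<noteq> {} \<and> (\<forall>P\<in>G. invertible P) \<and>
     (\<forall>P\<in>G. \<forall>Q\<in>G. P ** Q \<in> G) \<and> (\<forall>P\<in>G. matrix_inv P \<in> G)"

definition Lambda_set :: "(real^'n^'n) set \<Rightarrow> real^'n \<Rightarrow> (real^'n) set" where
  "Lambda_set G z0 = {P *v z0 - Q *v z0 | P Q. P \<in> G \<and> Q \<in> G}"

definition fin_dim_subspace :: "('a \<Rightarrow> real) set \<Rightarrow> bool" where
  "fin_dim_subspace V \<longleftrightarrow> (\<exists>B. finite B \<and>
     V = {(\<lambda>x. \<Sum>b\<in>B. c b * b x) | c. True})"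

definition is_polynomial :: "(real^'n \<Rightarrow> real) \<Rightarrow> bool" where
  "is_polynomial p \<longleftrightarrow> (\<exists>(A :: ('n \<Rightarrow> nat) set) c. finite A \<and>
     p = (\<lambda>x. \<Sum>\<alpha>\<in>A. c \<alpha> * (\<Prod>i\<in>UNIV. (x $ i) ^ (\<alpha> i))))"

fun pderivs :: "'n list \<Rightarrow> (real^'n \<Rightarrow> real) \<Rightarrow> real^'n \<Rightarrow> real" where
  "pderivs [] g = g"
| "pderivs (i # is) g = (\<lambda>x. deriv (\<lambda>t. pderivs is g (x + t *\<^sub>R axis i 1)) 0)"

definition smooth_fun :: "(real^'n \<Rightarrow> real) \<Rightarrow> bool" where
  "smooth_fun g \<longleftrightarrow> (\<forall>is. continuous_on UNIV (pderivs is g) \<and>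
     (\<forall>i x. (\<lambda>t. pderivs is g (x + t *\<^sub>R axis i 1)) differentiable (at 0)))"

definition test_fun :: "(real^'n \<Rightarrow> real) \<Rightarrow> bool" where
  "test_fun \<phi> \<longleftrightarrow> smooth_fun \<phi> \<and> compact (closure {x. \<phi> x \<noteq> 0})"

text \<open>Schwartz distributions: linear functionals on test functions, continuous
  (seminorm characterization). Convention: a distribution is normalized to be 0 on
  non-test functions, so that equality as distributions is literal equality.\<close>
definition distribution :: "((real^'n \<Rightarrow> real) \<Rightarrow> real) \<Rightarrow> bool" where
  "distribution f \<longleftrightarrow>
     (\<forall>\<phi>. \<not> test_fun \<phi> \<longrightarrow> f \<phi> = 0) \<and>
     (\<forall>\<phi> \<psi> a b. test_fun \<phi> \<longrightarrow> test_fun \<psi> \<longrightarrow>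
        f (\<lambda>x. a * \<phi> x + b * \<psi> x) = a * f \<phi> + b * f \<psi>) \<and>
     (\<forall>K. compact K \<longrightarrow> (\<exists>C N. \<forall>\<phi>. test_fun \<phi> \<and> closure {x. \<phi> x \<noteq> 0} \<subseteq> K \<longrightarrow>
        \<bar>f \<phi>\<bar> \<le> C * (\<Sum>is\<in>{is :: 'n list. length is \<le> N}.
                          (SUP x. \<bar>pderivs is \<phi> x\<bar>))))"

definition tau_C :: "real^'n \<Rightarrow> (real^'n \<Rightarrow> real) \<Rightarrow> (real^'n \<Rightarrow> real)" where
  "tau_C h g = (\<lambda>x. g (x + h))"

definition O_C :: "real^'n^'n \<Rightarrow> (real^'n \<Rightarrow> real) \<Rightarrow> (real^'n \<Rightarrow> real)" where
  "O_C P g = (\<lambda>x. g (P *v x))"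

definition tau_D :: "real^'n \<Rightarrow> ((real^'n \<Rightarrow> real) \<Rightarrow> real) \<Rightarrow> ((real^'n \<Rightarrow> real) \<Rightarrow> real)" where
  "tau_D h f = (\<lambda>\<phi>. if test_fun \<phi> then f (\<lambda>x. \<phi> (x - h)) else 0)"

definition O_D :: "real^'n^'n \<Rightarrow> ((real^'n \<Rightarrow> real) \<Rightarrow> real) \<Rightarrow> ((real^'n \<Rightarrow> real) \<Rightarrow> real)" where
  "O_D P f = (\<lambda>\<phi>. if test_fun \<phi> then f (\<lambda>x. \<phi> (matrix_inv P *v x)) / \<bar>det P\<bar> else 0)"

definition poly_distribution :: "((real^'n \<Rightarrow> real) \<Rightarrow> real) \<Rightarrow> bool" where
  "poly_distribution f \<longleftrightarrow> (\<exists>p. is_polynomial p \<and>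
     (\<forall>\<phi>. test_fun \<phi> \<longrightarrow> f \<phi> = integral UNIV (\<lambda>x. p x * \<phi> x)))"

end

theory Submission
  imports Defs
begin

text \<open>
  Write \<open>\<tau>\<^sub>h\<close> for the translations on \<open>V\<close>. For \<open>P, Q \<in> G\<close> the operator \<open>\<tau>\<^bsub>nPz\<^sub>0 - nQz\<^sub>0\<^esub>\<close> is
  \<open>O\<^sub>P\<^sup>-\<^sup>1 \<tau>\<^bsub>nz\<^sub>0\<^esub> X \<tau>\<^bsub>-nz\<^sub>0\<^esub> O\<^sub>Q\<close> with \<open>X = O\<^sub>P O\<^sub>Q\<^sup>-\<^sup>1\<close>. Since the maps
  \<open>X \<mapsto> \<tau>\<^bsub>nz\<^sub>0\<^esub> X \<tau>\<^bsub>-nz\<^sub>0\<^esub>\<close> live in a finite-dimensional space, there are coefficients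
  \<open>q\<^sub>n\<close>, not all zero, with \<open>\<Sum>q\<^sub>n \<tau>\<^bsub>nh\<^esub> = 0\<close> on \<open>V\<close> for all \<open>h \<in> \<Lambda>\<close>. As \<open>h\<close> ranges over an open
  set, all but one of the terms can be eliminated by differencing, which gives Frechet's equation
  \<open>\<Delta>\<^sub>v\<^sup>N f = 0\<close> for every \<open>v\<close>. Its continuous solutions are polynomials by Newton interpolation in
  each coordinate, and its distributional solutions are continuous functions because convolution
  with a suitable test function reproduces them.
\<close>

section \<open>Finite differences\<close>

definition fdiff :: "'a::ab_group_add \<Rightarrow> ('a \<Rightarrow> 'b::ab_group_add) \<Rightarrow> 'a \<Rightarrow> 'b" where
  "fdiff v F = (\<lambda>x. F (x + v) - F x)"

text \<open>These are the solutions of Frechet's functional equation. The index bounds the degree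
  strictly from above, so that only \<open>0\<close> has index \<open>0\<close>.\<close>
definition generalized_polynomial ::
    "nat \<Rightarrow> ('a::ab_group_add \<Rightarrow> 'b::ab_group_add) \<Rightarrow> bool" where
  "generalized_polynomial N F \<longleftrightarrow> (\<forall>v. (fdiff v ^^ N) F = (\<lambda>_. 0))"

lemma generalized_polynomialD: "generalized_polynomial N F \<Longrightarrow> (fdiff v ^^ N) F = (\<lambda>_. 0)"
  by (simp add: generalized_polynomial_def)

lemma fdiff_zero [simp]: "fdiff v (\<lambda>_. 0) = (\<lambda>_. 0)"
  by (simp add: fdiff_def)

lemma fdiff_funpow_zero [simp]: "(fdiff v ^^ n) (\<lambda>_. 0) = (\<lambda>_. 0)"
  by (induction n) simp_all

lemma fdiff_funpow_fdiff_commute: "(fdiff v ^^ n) (fdiff w F) = fdiff w ((fdiff v ^^ n) F)"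
  by (induction n) (simp_all add: fdiff_def algebra_simps)

lemma fdiff_funpow_commute: "(fdiff v ^^ n) ((fdiff w ^^ m) F) = (fdiff w ^^ m) ((fdiff v ^^ n) F)"
  by (induction m) (simp_all add: fdiff_funpow_fdiff_commute)

lemma fdiff_funpow_comp:
  assumes "\<And>x. \<pi> (x + v) = \<pi> x + w"
  shows "(fdiff v ^^ n) (\<lambda>x. F (\<pi> x)) = (\<lambda>x. (fdiff w ^^ n) F (\<pi> x))"
  by (induction n) (simp_all add: fdiff_def assms)

lemma continuous_on_fdiff_funpow:
  fixes F :: "'a::real_normed_vector \<Rightarrow> 'b::real_normed_vector"
  assumes "continuous_on UNIV F"
  shows "continuous_on UNIV ((fdiff v ^^ n) F)"
proof (induction n)
  case (Suc n)
  have "continuous_on UNIV (\<lambda>x. (fdiff v ^^ n) F (x + v))"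
    by (rule continuous_on_compose2[OF Suc]) (auto intro!: continuous_intros)
  then show ?case
    using Suc by (auto simp: fdiff_def[of v "(fdiff v ^^ n) F"] intro!: continuous_intros)
qed (use assms in simp)

lemma generalized_polynomial_fdiff_funpow:
  "generalized_polynomial N F \<Longrightarrow> generalized_polynomial N ((fdiff w ^^ n) F)"
  by (simp add: generalized_polynomial_def fdiff_funpow_commute[where w = w])

lemma generalized_polynomial_comp_affine:
  assumes "generalized_polynomial N F" and "\<And>x v. \<pi> (x + v) = \<pi> x + L v"
  shows "generalized_polynomial N (\<lambda>x. F (\<pi> x))"
  using assms by (simp add: generalized_polynomial_def fdiff_funpow_comp[where \<pi> = \<pi>])

lemma fdiff_funpow_eq_zero_ge:
  assumes "(fdiff v ^^ N) F = (\<lambda>_. 0)" "N \<le> n"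
  shows "(fdiff v ^^ n) F = (\<lambda>_. 0)"
proof -
  have "(fdiff v ^^ n) F = (fdiff v ^^ (n - N)) ((fdiff v ^^ N) F)"
    using fun_cong[OF funpow_add[of "n - N" N "fdiff v"], of F] assms(2) by simp
  then show ?thesis by (simp add: assms(1))
qed

lemma fdiff_funpow_eq_zero_multiple:
  fixes v :: "'a::real_vector"
  assumes "(fdiff v ^^ N) F = (\<lambda>_. 0)"
  shows "(fdiff (real k *\<^sub>R v) ^^ N) F = (\<lambda>_. 0)"
  using assms
proof (induction N arbitrary: F)
  case (Suc N)
  define H where "H = (fdiff v ^^ N) F"
  have "fdiff v H = (\<lambda>_. 0)"
    using Suc.prems by (simp add: H_def)
  then have periodic: "H (x + v) = H x" for x
    by (simp add: fdiff_def fun_eq_iff)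
  have "H (x + real k *\<^sub>R v) = H x" for x
  proof (induction k)
    case (Suc k)
    have "H (x + real (Suc k) *\<^sub>R v) = H ((x + real k *\<^sub>R v) + v)"
      by (simp add: algebra_simps)
    then show ?case using Suc periodic by metis
  qed simp
  then have "(fdiff v ^^ N) (fdiff (real k *\<^sub>R v) F) = (\<lambda>_. 0)"
    by (simp add: fdiff_funpow_fdiff_commute fdiff_def[of _ H] flip: H_def)
  then show ?case
    using Suc.IH by (simp add: funpow_swap1)
qed simp

lemma generalized_polynomial_if_small:
  fixes F :: "'a::real_normed_vector \<Rightarrow> 'b::ab_group_add"
  assumes "\<forall>\<^sub>F v in nhds 0. (fdiff v ^^ N) F = (\<lambda>_. 0)"
  shows "generalized_polynomial N F"
  unfolding generalized_polynomial_def
proof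
  fix v :: 'a
  obtain \<delta> where "\<delta> > 0" and \<delta>: "\<And>w. norm w < \<delta> \<Longrightarrow> (fdiff w ^^ N) F = (\<lambda>_. 0)"
    using assms unfolding eventually_nhds_metric by (auto simp: dist_norm)
  obtain k where "norm v / \<delta> < real k" "k > 0"
    using reals_Archimedean2[of "norm v / \<delta>"] \<open>\<delta> > 0\<close>
    by (metis divide_nonneg_pos norm_ge_zero not_le of_nat_0_less_iff order_le_less_trans)
  then have "norm ((1 / real k) *\<^sub>R v) < \<delta>"
    using \<open>\<delta> > 0\<close> by (simp add: field_simps)
  from fdiff_funpow_eq_zero_multiple[OF \<delta>[OF this], of k]
  show "(fdiff v ^^ N) F = (\<lambda>_. 0)" using \<open>k > 0\<close> by simp
qed

lemma fdiff_funpow_binomial: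
  fixes F :: "'a::real_vector \<Rightarrow> 'b::real_vector"
  shows "(fdiff v ^^ N) F x =
    (-1) ^ N *\<^sub>R (\<Sum>k\<le>N. ((-1) ^ k * real (N choose k)) *\<^sub>R F (x + real k *\<^sub>R v))"
proof (induction N arbitrary: F)
  case (Suc N)
  define a where "a k = F (x + real k *\<^sub>R v)" for k
  have "(\<Sum>k\<le>Suc N. ((-1) ^ k * real (Suc N choose k)) *\<^sub>R a k) =
      a 0 + (\<Sum>k\<le>N. ((-1) ^ Suc k * real (Suc N choose Suc k)) *\<^sub>R a (Suc k))"
    by (subst sum.atMost_Suc_shift) simp
  also have "\<dots> = (a 0 + (\<Sum>k\<le>N. ((-1) ^ Suc k * real (N choose Suc k)) *\<^sub>R a (Suc k)))
      - (\<Sum>k\<le>N. ((-1) ^ k * real (N choose k)) *\<^sub>R a (Suc k))"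
  proof -
    have "((-1) ^ Suc k * real (Suc N choose Suc k)) *\<^sub>R a (Suc k) =
        ((-1) ^ Suc k * real (N choose Suc k)) *\<^sub>R a (Suc k)
        - ((-1) ^ k * real (N choose k)) *\<^sub>R a (Suc k)" for k
      by (simp add: algebra_simps)
    then show ?thesis by (simp only: sum_subtractf add_diff_eq)
  qed
  also have "a 0 + (\<Sum>k\<le>N. ((-1) ^ Suc k * real (N choose Suc k)) *\<^sub>R a (Suc k)) =
      (\<Sum>k\<le>Suc N. ((-1) ^ k * real (N choose k)) *\<^sub>R a k)"
    by (subst sum.atMost_Suc_shift) simp
  also have "\<dots> = (\<Sum>k\<le>N. ((-1) ^ k * real (N choose k)) *\<^sub>R a k)"
    by simp
  finally have pascal: "(\<Sum>k\<le>Suc N. ((-1) ^ k * real (Suc N choose k)) *\<^sub>R a k) =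
      - (\<Sum>k\<le>N. ((-1) ^ k * real (N choose k)) *\<^sub>R (a (Suc k) - a k))"
    by (simp add: algebra_simps sum_subtractf)
  have "(fdiff v ^^ Suc N) F x = (fdiff v ^^ N) (fdiff v F) x"
    by (simp only: funpow_Suc_right o_apply)
  also have "\<dots> = (-1) ^ N *\<^sub>R (\<Sum>k\<le>N. ((-1) ^ k * real (N choose k)) *\<^sub>R (a (Suc k) - a k))"
    unfolding Suc by (simp add: fdiff_def a_def algebra_simps)
  finally show ?case
    using pascal by (simp add: a_def)
qed simp

lemma newton_forward:
  fixes u :: "'a::real_vector \<Rightarrow> 'b::real_vector"
  shows "u (x + real m *\<^sub>R h) = (\<Sum>k\<le>m. real (m choose k) *\<^sub>R (fdiff h ^^ k) u x)"
proof (induction m arbitrary: u)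
  case (Suc m)
  have "u (x + real (Suc m) *\<^sub>R h) = u (x + real m *\<^sub>R h) + fdiff h u (x + real m *\<^sub>R h)"
    by (simp add: fdiff_def algebra_simps)
  also have "\<dots> = (\<Sum>k\<le>m. real (m choose k) *\<^sub>R (fdiff h ^^ k) u x)
      + (\<Sum>k\<le>m. real (m choose k) *\<^sub>R (fdiff h ^^ Suc k) u x)"
    by (simp only: Suc funpow_Suc_right o_apply)
  also have "(\<Sum>k\<le>m. real (m choose k) *\<^sub>R (fdiff h ^^ k) u x) =
      (\<Sum>k\<le>Suc m. real (m choose k) *\<^sub>R (fdiff h ^^ k) u x)"
    by simp
  also have "\<dots> = u x + (\<Sum>k\<le>m. real (m choose Suc k) *\<^sub>R (fdiff h ^^ Suc k) u x)"
    by (subst sum.atMost_Suc_shift) simp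
  also have "\<dots> + (\<Sum>k\<le>m. real (m choose k) *\<^sub>R (fdiff h ^^ Suc k) u x) =
     u x + (\<Sum>k\<le>m. real (Suc m choose Suc k) *\<^sub>R (fdiff h ^^ Suc k) u x)"
    by (simp add: sum.distrib[symmetric] algebra_simps)
  also have "\<dots> = (\<Sum>k\<le>Suc m. real (Suc m choose k) *\<^sub>R (fdiff h ^^ k) u x)"
    by (subst sum.atMost_Suc_shift) simp
  finally show ?case .
qed simp

lemma newton_forward_truncated:
  fixes u :: "'a::real_vector \<Rightarrow> 'b::real_vector"
  assumes "(fdiff h ^^ N) u = (\<lambda>_. 0)"
  shows "u (x + real m *\<^sub>R h) = (\<Sum>k<N. real (m choose k) *\<^sub>R (fdiff h ^^ k) u x)"
proof -
  have "u (x + real m *\<^sub>R h) = (\<Sum>k\<le>m. real (m choose k) *\<^sub>R (fdiff h ^^ k) u x)"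
    by (rule newton_forward)
  also have "\<dots> = (\<Sum>k\<le>m+N. real (m choose k) *\<^sub>R (fdiff h ^^ k) u x)"
    by (rule sum.mono_neutral_left) auto
  also have "\<dots> = (\<Sum>k<N. real (m choose k) *\<^sub>R (fdiff h ^^ k) u x)"
    by (rule sum.mono_neutral_right) (auto simp: fdiff_funpow_eq_zero_ge[OF assms])
  finally show ?thesis .
qed

section \<open>Continuous generalized polynomials\<close>

definition newton_poly :: "nat \<Rightarrow> (nat \<Rightarrow> 'a::field_char_0) \<Rightarrow> 'a poly" where
  "newton_poly N c = (\<Sum>k<N. smult (c k / fact k) (\<Prod>j<k. [:- of_nat j, 1:]))"

lemma poly_newton_poly: "poly (newton_poly N c) t = (\<Sum>k<N. (t gchoose k) * c k)"
  by (simp add: newton_poly_def poly_sum poly_prod gbinomial_prod_rev atLeast0LessThan mult.commute)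

lemma poly_eq_if_eq_on_nats:
  fixes p q :: "'a::field_char_0 poly"
  assumes "\<And>m. poly p (of_nat m) = poly q (of_nat m)"
  shows "p = q"
proof -
  have "range of_nat \<subseteq> {t. poly (p - q) t = 0}"
    using assms by auto
  then have "infinite {t. poly (p - q) t = 0}"
    using infinite_super range_inj_infinite[OF inj_of_nat] by blast
  then show ?thesis
    using poly_roots_finite[of "p - q"] by auto
qed

text \<open>The Newton polynomials of all steps \<open>1 / q\<close> and all integer base points agree with \<open>u\<close> on large
  integers and hence coincide; so \<open>u\<close> is this one polynomial on the rationals.\<close>
lemma generalized_polynomial_real:
  fixes u :: "real \<Rightarrow> real"
  assumes cont: "continuous_on UNIV u" and gen: "generalized_polynomial N u"
  shows "u t = (\<Sum>k<N. (t gchoose k) * (fdiff 1 ^^ k) u 0)"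
proof -
  define P where "P a h = pcompose (newton_poly N (\<lambda>k. (fdiff h ^^ k) u a)) [:- a / h, 1 / h:]"
    for a h
  have P_grid: "u (a + real j * h) = poly (P a h) (a + real j * h)" if "h \<noteq> 0" for a h j
    using newton_forward_truncated[OF generalized_polynomialD[OF gen], of a j h] that
    by (simp add: P_def poly_pcompose poly_newton_poly binomial_gbinomial
        diff_divide_distrib add_divide_distrib)
  have P_unique: "P (- real a) (1 / real q) = P 0 1" if "q > 0" for a q :: nat
  proof (rule poly_eq_if_eq_on_nats)
    fix m
    have "real m = - real a + real ((m + a) * q) * (1 / real q)"
      using that by simp
    then have "u (real m) = poly (P (- real a) (1 / real q)) (real m)"
      using P_grid[of "1 / real q" "- real a" "(m + a) * q"] that by simp
    then show "poly (P (- real a) (1 / real q)) (real m) = poly (P 0 1) (real m)"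
      using P_grid[of 1 0 m] by simp
  qed
  have u_rat: "u r = poly (P 0 1) r" if "r \<in> \<rat>" for r
  proof -
    obtain i :: int and q :: nat where r: "r = of_int i / real q" and "q > 0"
      using \<open>r \<in> \<rat>\<close> by (metis Rats_cases' of_int_of_nat_eq zero_less_imp_eq_int of_nat_0_less_iff)
    define a where "a = nat \<bar>i\<bar>"
    define j where "j = nat (i + int (a * q))"
    have "0 \<le> i + int (a * q)"
      using mult_left_mono[of 1 "int q" "\<bar>i\<bar>"] \<open>q > 0\<close> by (simp add: a_def)
    then have "r = - real a + real j * (1 / real q)"
      using \<open>q > 0\<close> by (simp add: r j_def field_simps)
    then show ?thesis
      using P_grid[of "1 / real q" "- real a" j] P_unique \<open>q > 0\<close> by simp
  qed
  have "u t - poly (P 0 1) t = 0"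
  proof (rule continuous_constant_on_closure[where S = \<rat> and f = "\<lambda>t. u t - poly (P 0 1) t"])
    show "continuous_on (closure \<rat>) (\<lambda>t. u t - poly (P 0 1) t)"
      using cont by (auto simp: Rats_closure_real intro!: continuous_intros)
  qed (auto simp: u_rat Rats_closure_real)
  then show ?thesis
    by (simp add: P_def poly_pcompose poly_newton_poly)
qed

lemma generalized_polynomial_on_line:
  fixes F :: "'a::real_normed_vector \<Rightarrow> real"
  assumes cont: "continuous_on UNIV F" and gen: "generalized_polynomial N F"
  shows "F (x + t *\<^sub>R v) = (\<Sum>k<N. (t gchoose k) * (fdiff v ^^ k) F x)"
proof -
  define u where "u t = F (x + t *\<^sub>R v)" for t
  have "continuous_on UNIV u"
    unfolding u_def by (rule continuous_on_compose2[OF cont]) (auto intro!: continuous_intros)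
  moreover have "generalized_polynomial N u"
    unfolding u_def
    by (rule generalized_polynomial_comp_affine[OF gen, where L = "\<lambda>t. t *\<^sub>R v"])
      (simp add: algebra_simps)
  ultimately have "u t = (\<Sum>k<N. (t gchoose k) * (fdiff 1 ^^ k) u 0)"
    by (rule generalized_polynomial_real)
  moreover have "(fdiff 1 ^^ k) u 0 = (fdiff v ^^ k) F x" for k
    unfolding u_def by (subst fdiff_funpow_comp[where w = v]) (simp_all add: algebra_simps)
  ultimately show ?thesis by (simp add: u_def)
qed

lemma real_polynomial_function_inner_gchoose:
  "real_polynomial_function (\<lambda>x. (x \<bullet> b) gchoose k)"
proof -
  have "real_polynomial_function (\<lambda>x. (\<Prod>i<k. x \<bullet> b - real i) / fact k)"
    by (intro real_polynomial_function_divide real_polynomial_function_prod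
        real_polynomial_function_diff real_polynomial_function.intros
        bounded_linear_inner_left) simp
  then show ?thesis by (simp add: gbinomial_prod_rev atLeast0LessThan)
qed

theorem continuous_generalized_polynomial_imp_real_polynomial_function:
  fixes F :: "'a::euclidean_space \<Rightarrow> real"
  assumes cont: "continuous_on UNIV F" and gen: "generalized_polynomial N F"
  shows "real_polynomial_function F"
proof -
  define proj where "proj B x = (\<Sum>b\<in>B. (x \<bullet> b) *\<^sub>R b)" for B and x :: 'a
  have "real_polynomial_function (\<lambda>x. F (proj B x))" if "finite B" for B
    using that cont gen
  proof (induction B arbitrary: F)
    case empty
    then show ?case by (simp add: proj_def real_polynomial_function.intros)
  next
    case (insert b B)
    have "proj (insert b B) x = proj B x + (x \<bullet> b) *\<^sub>R b" for x
      using insert.hyps by (simp add: proj_def)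
    then have "F (proj (insert b B) x) =
        (\<Sum>k<N. ((x \<bullet> b) gchoose k) * (fdiff b ^^ k) F (proj B x))" for x
      using generalized_polynomial_on_line[OF insert.prems] by simp
    moreover have "real_polynomial_function (\<lambda>x. (fdiff b ^^ k) F (proj B x))" for k
      using insert by (simp add: continuous_on_fdiff_funpow generalized_polynomial_fdiff_funpow)
    ultimately show ?case
      by (simp add: real_polynomial_function_sum real_polynomial_function.intros(4)
          real_polynomial_function_inner_gchoose)
  qed
  from this[of Basis] show ?thesis
    by (simp add: proj_def euclidean_representation)
qed

lemma is_polynomialI:
  fixes \<alpha> :: "'j \<Rightarrow> 'n::finite \<Rightarrow> nat"
  assumes "finite J" and "\<And>x. p x = (\<Sum>j\<in>J. c j * (\<Prod>i\<in>UNIV. (x $ i) ^ \<alpha> j i))"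
  shows "is_polynomial p"
  unfolding is_polynomial_def
proof (intro exI conjI)
  show "finite (\<alpha> ` J)" using assms(1) by simp
  show "p = (\<lambda>x. \<Sum>a\<in>\<alpha> ` J. (\<Sum>j\<in>{j\<in>J. \<alpha> j = a}. c j) * (\<Prod>i\<in>UNIV. (x $ i) ^ a i))"
  proof
    fix x
    have "p x = (\<Sum>a\<in>\<alpha> ` J. \<Sum>j\<in>{j\<in>J. \<alpha> j = a}. c j * (\<Prod>i\<in>UNIV. (x $ i) ^ \<alpha> j i))"
      unfolding assms(2) by (rule sum.image_gen[OF assms(1)])
    then show "p x = (\<Sum>a\<in>\<alpha> ` J. (\<Sum>j\<in>{j\<in>J. \<alpha> j = a}. c j) * (\<Prod>i\<in>UNIV. (x $ i) ^ a i))"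
      by (simp add: sum_distrib_right)
  qed
qed

lemma is_polynomial_const: "is_polynomial (\<lambda>x. c)"
  by (rule is_polynomialI[of "{()}" _ "\<lambda>_. c" "\<lambda>_ _. 0"]) auto

lemma is_polynomial_linear:
  fixes f :: "real^'n \<Rightarrow> real"
  assumes "linear f"
  shows "is_polynomial f"
proof (rule is_polynomialI[of UNIV _ "\<lambda>j. f (axis j 1)" "\<lambda>j i. if i = j then 1 else 0"])
  fix x :: "real^'n"
  have coordinate: "(\<Prod>i\<in>UNIV. (x $ i) ^ (if i = j then 1 else 0)) = x $ j" for j
    by (simp add: if_distrib[of "(^) _"] cong: if_cong)
  have "f x = f (\<Sum>j\<in>UNIV. (x $ j) *\<^sub>R axis j 1)"
    using basis_expansion[of x] by (simp add: scalar_mult_eq_scaleR)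
  also have "\<dots> = (\<Sum>j\<in>UNIV. f (axis j 1) * x $ j)"
    by (simp add: linear_sum[OF assms] linear_cmul[OF assms] mult.commute)
  finally show "f x = (\<Sum>j\<in>UNIV. f (axis j 1) * (\<Prod>i\<in>UNIV. (x $ i) ^ (if i = j then 1 else 0)))"
    by (simp only: coordinate)
qed simp

lemma is_polynomial_add:
  assumes "is_polynomial p" "is_polynomial q"
  shows "is_polynomial (\<lambda>x. p x + q x)"
proof -
  obtain A c where A: "finite A" "p = (\<lambda>x. \<Sum>\<alpha>\<in>A. c \<alpha> * (\<Prod>i\<in>UNIV. (x $ i) ^ \<alpha> i))"
    using assms(1) unfolding is_polynomial_def by blast
  obtain B d where B: "finite B" "q = (\<lambda>x. \<Sum>\<alpha>\<in>B. d \<alpha> * (\<Prod>i\<in>UNIV. (x $ i) ^ \<alpha> i))"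
    using assms(2) unfolding is_polynomial_def by blast
  show ?thesis
  proof (rule is_polynomialI[of "A <+> B" _ "case_sum c d" "case_sum id id"])
    show "p x + q x = (\<Sum>j\<in>A <+> B. case_sum c d j * (\<Prod>i\<in>UNIV. x $ i ^ case_sum id id j i))" for x
      using A B by (simp add: sum.Plus)
  qed (use A B in auto)
qed

lemma is_polynomial_mult:
  assumes "is_polynomial p" "is_polynomial q"
  shows "is_polynomial (\<lambda>x. p x * q x)"
proof -
  obtain A c where A: "finite A" "p = (\<lambda>x. \<Sum>\<alpha>\<in>A. c \<alpha> * (\<Prod>i\<in>UNIV. (x $ i) ^ \<alpha> i))"
    using assms(1) unfolding is_polynomial_def by blast
  obtain B d where B: "finite B" "q = (\<lambda>x. \<Sum>\<alpha>\<in>B. d \<alpha> * (\<Prod>i\<in>UNIV. (x $ i) ^ \<alpha> i))"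
    using assms(2) unfolding is_polynomial_def by blast
  show ?thesis
  proof (rule is_polynomialI[of "A \<times> B" _ "\<lambda>(a, b). c a * d b" "\<lambda>(a, b) i. a i + b i"])
    show "p x * q x = (\<Sum>j\<in>A \<times> B. (case j of (a, b) \<Rightarrow> c a * d b) *
        (\<Prod>i\<in>UNIV. x $ i ^ (case j of (a, b) \<Rightarrow> \<lambda>i. a i + b i) i))" for x
      unfolding A(2) B(2) sum_product sum.cartesian_product
      by (rule sum.cong) (auto simp: power_add prod.distrib)
  qed (use A B in auto)
qed

lemma real_polynomial_function_imp_is_polynomial:
  "real_polynomial_function p \<Longrightarrow> is_polynomial p"
  by (induction rule: real_polynomial_function.induct)
    (simp_all add: is_polynomial_linear bounded_linear.linear is_polynomial_const
      is_polynomial_add is_polynomial_mult)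

corollary continuous_generalized_polynomial_imp_is_polynomial:
  assumes "continuous_on UNIV F" "generalized_polynomial N F"
  shows "is_polynomial F"
  using assms continuous_generalized_polynomial_imp_real_polynomial_function
    real_polynomial_function_imp_is_polynomial by blast

section \<open>Sums of dilates\<close>

text \<open>Replacing \<open>(y, h)\<close> by \<open>(y - c j u, h + u)\<close> fixes \<open>y + c j h\<close>, so subtracting the two
  relations removes the term with index \<open>j\<close> and differences the others.\<close>
lemma sum_dilates_eliminate:
  fixes f :: "'i \<Rightarrow> 'a::real_vector \<Rightarrow> 'b::ab_group_add"
  assumes "finite I" "j \<notin> I"
    and at_h: "\<And>y. (\<Sum>i\<in>insert j I. f i (y + c i *\<^sub>R h)) = 0"
    and at_shift: "\<And>y. (\<Sum>i\<in>insert j I. f i (y + c i *\<^sub>R (h + u))) = 0"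
  shows "(\<Sum>i\<in>I. fdiff ((c i - c j) *\<^sub>R u) (f i) (y + c i *\<^sub>R h)) = 0"
proof -
  have shift: "y - c j *\<^sub>R u + c i *\<^sub>R (h + u) = y + c i *\<^sub>R h + (c i - c j) *\<^sub>R u" for i
    by (simp add: algebra_simps)
  have "(\<Sum>i\<in>I. fdiff ((c i - c j) *\<^sub>R u) (f i) (y + c i *\<^sub>R h)) =
      (\<Sum>i\<in>insert j I. f i (y - c j *\<^sub>R u + c i *\<^sub>R (h + u))) - (\<Sum>i\<in>insert j I. f i (y + c i *\<^sub>R h))"
    unfolding shift using assms(1,2) by (simp add: fdiff_def sum_subtractf)
  then show ?thesis by (simp only: at_h at_shift diff_self)
qed

lemma generalized_polynomial_if_sum_dilates_eq_zero:
  fixes f :: "'i \<Rightarrow> 'a::real_normed_vector \<Rightarrow> 'b::ab_group_add" and c :: "'i \<Rightarrow> real"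
  assumes "finite J" "c m \<notin> c ` J" "open U" "U \<noteq> {}"
    and "\<And>y h. h \<in> U \<Longrightarrow> (\<Sum>i\<in>insert m J. f i (y + c i *\<^sub>R h)) = 0"
  shows "generalized_polynomial (card J) (f m)"
  using assms
proof (induction J arbitrary: f U rule: finite_induct)
  case empty
  then obtain h where "h \<in> U" by blast
  have "f m x = 0" for x
    using empty.prems(4)[OF \<open>h \<in> U\<close>, of "x - c m *\<^sub>R h"] by simp
  then show ?case by (auto simp: generalized_polynomial_def)
next
  case (insert j J)
  define d where "d = c m - c j"
  have "d \<noteq> 0" "j \<notin> insert m J" using insert.prems(1) insert.hyps by (auto simp: d_def)
  obtain h0 where "h0 \<in> U" using insert.prems(3) by blast
  have annihilates: "(fdiff v ^^ Suc (card J)) (f m) = (\<lambda>_. 0)" if v: "h0 + (1 / d) *\<^sub>R v \<in> U" for v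
  proof -
    define u where "u = (1 / d) *\<^sub>R v"
    have "generalized_polynomial (card J) (fdiff ((c m - c j) *\<^sub>R u) (f m))"
    proof (rule insert.IH[where f = "\<lambda>i. fdiff ((c i - c j) *\<^sub>R u) (f i)"])
      show "open (U \<inter> (\<lambda>h. h + u) -` U)"
        by (intro open_Int open_vimage insert.prems(2) continuous_intros)
      show "U \<inter> (\<lambda>h. h + u) -` U \<noteq> {}"
        using \<open>h0 \<in> U\<close> v by (auto simp: u_def)
      show "(\<Sum>i\<in>insert m J. fdiff ((c i - c j) *\<^sub>R u) (f i) (y + c i *\<^sub>R h)) = 0"
        if "h \<in> U \<inter> (\<lambda>h. h + u) -` U" for y h
        using that insert.hyps(1) \<open>j \<notin> insert m J\<close> insert.prems(4)
        by (intro sum_dilates_eliminate) (auto simp: insert_commute)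
    qed (use insert.prems in auto)
    then have "generalized_polynomial (card J) (fdiff v (f m))"
      using \<open>d \<noteq> 0\<close> by (simp add: u_def flip: d_def)
    then show ?thesis
      using generalized_polynomialD by (metis funpow_Suc_right o_apply)
  qed
  have "((\<lambda>v. h0 + (1 / d) *\<^sub>R v) \<longlongrightarrow> h0 + (1 / d) *\<^sub>R 0) (nhds 0)"
    by (intro tendsto_intros filterlim_ident)
  then have "\<forall>\<^sub>F v in nhds 0. h0 + (1 / d) *\<^sub>R v \<in> U"
    using \<open>h0 \<in> U\<close> insert.prems(2) by (simp add: topological_tendstoD)
  then have "\<forall>\<^sub>F v in nhds 0. (fdiff v ^^ Suc (card J)) (f m) = (\<lambda>_. 0)"
    by eventually_elim (rule annihilates)
  then show ?case
    using generalized_polynomial_if_small insert.hyps by fastforce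
qed

section \<open>Relations between endomorphisms of a finite-dimensional space\<close>

lemma exists_nontrivial_linear_relation:
  fixes v :: "'i \<Rightarrow> 's \<Rightarrow> 'k::field"
  assumes "finite S" "finite I" "card S < card I"
  shows "\<exists>q. (\<exists>i\<in>I. q i \<noteq> 0) \<and> (\<forall>s\<in>S. (\<Sum>i\<in>I. q i * v i s) = 0)"
  using assms
proof (induction S arbitrary: I rule: finite_induct)
  case empty
  then have "I \<noteq> {}" by auto
  then show ?case by (intro exI[of _ "\<lambda>_. 1"]) auto
next
  case (insert s S)
  obtain q j where j: "j \<in> I" "q j \<noteq> 0" and q: "\<And>t. t \<in> S \<Longrightarrow> (\<Sum>i\<in>I. q i * v i t) = 0"
    using insert.IH[of I] insert.prems insert.hyps by fastforce
  obtain p k where k: "k \<in> I - {j}" "p k \<noteq> 0"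
    and p: "\<And>t. t \<in> S \<Longrightarrow> (\<Sum>i\<in>I - {j}. p i * v i t) = 0"
    using insert.IH[of "I - {j}"] insert.prems insert.hyps j(1) by fastforce
  define p' where "p' = p(j := 0)"
  have sum_p': "(\<Sum>i\<in>I. p' i * v i t) = (\<Sum>i\<in>I - {j}. p i * v i t)" for t
    using sum.remove[OF insert.prems(1) j(1), of "\<lambda>i. p' i * v i t"] by (simp add: p'_def)
  define \<sigma> where "\<sigma> r = (\<Sum>i\<in>I. r i * v i s)" for r
  show ?case
  proof (cases "\<sigma> p' = 0")
    case True
    moreover have "k \<in> I" "p' k \<noteq> 0"
      using k by (auto simp: p'_def)
    ultimately show ?thesis
      using p by (intro exI[of _ p'] conjI bexI[of _ k]) (auto simp: sum_p' \<sigma>_def)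
  next
    case False
    define r where "r i = q i - \<sigma> q / \<sigma> p' * p' i" for i
    have sum_r: "(\<Sum>i\<in>I. r i * v i t) =
        (\<Sum>i\<in>I. q i * v i t) - \<sigma> q / \<sigma> p' * (\<Sum>i\<in>I. p' i * v i t)" for t
      by (simp add: r_def left_diff_distrib sum_subtractf sum_distrib_left mult.assoc)
    have "\<sigma> r = 0"
      using False unfolding \<sigma>_def[of r] sum_r by (simp flip: \<sigma>_def)
    moreover have "r j \<noteq> 0"
      using j(2) by (simp add: r_def p'_def)
    ultimately show ?thesis
      using j(1) p q by (intro exI[of _ r] conjI bexI[of _ j]) (auto simp: sum_r sum_p' \<sigma>_def)
  qed
qed

definition linear_endo_on :: "('a \<Rightarrow> real) set \<Rightarrow> (('a \<Rightarrow> real) \<Rightarrow> 'a \<Rightarrow> real) \<Rightarrow> bool" where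
  "linear_endo_on V L \<longleftrightarrow> L ` V \<subseteq> V \<and> (\<forall>f g. L (\<lambda>x. f x + g x) = (\<lambda>x. L f x + L g x)) \<and>
     (\<forall>c f. L (\<lambda>x. c * f x) = (\<lambda>x. c * L f x))"

lemma linear_endo_on_mem: "linear_endo_on V L \<Longrightarrow> g \<in> V \<Longrightarrow> L g \<in> V"
  by (auto simp: linear_endo_on_def)

lemma linear_endo_on_sum:
  assumes "linear_endo_on V L"
  shows "L (\<lambda>x. \<Sum>i\<in>I. c i * f i x) = (\<lambda>x. \<Sum>i\<in>I. c i * L (f i) x)"
proof -
  have add: "L (\<lambda>x. f x + g x) = (\<lambda>x. L f x + L g x)"
    and scale: "L (\<lambda>x. c * f x) = (\<lambda>x. c * L f x)" for f g c
    using assms by (auto simp: linear_endo_on_def)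
  have "L (\<lambda>x. 0) = (\<lambda>x. 0)" using scale[of 0] by simp
  then show ?thesis
    by (induction I rule: infinite_finite_induct) (simp_all add: add scale)
qed

lemma linear_endo_on_comp:
  "linear_endo_on V L \<Longrightarrow> linear_endo_on V M \<Longrightarrow> linear_endo_on V (\<lambda>f. L (M f))"
  by (auto simp: linear_endo_on_def image_subset_iff)

lemma fin_dim_subspace_coordinates:
  assumes "fin_dim_subspace V"
  obtains B c where "finite B" "B \<subseteq> V" "\<And>g. g \<in> V \<Longrightarrow> g = (\<lambda>x. \<Sum>b\<in>B. c g b * b x)"
proof -
  obtain B where "finite B" and V: "V = {(\<lambda>x. \<Sum>b\<in>B. c b * b x) | c. True}"
    using assms by (auto simp: fin_dim_subspace_def)
  have "b \<in> V" if "b \<in> B" for b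
  proof -
    have "b = (\<lambda>x. \<Sum>b'\<in>B. (if b' = b then 1 else 0) * b' x)"
      using \<open>finite B\<close> that by (simp add: if_distrib[of "\<lambda>c. c * _"] cong: if_cong)
    then show ?thesis
      unfolding V mem_Collect_eq by (intro exI[of _ "\<lambda>b'. if b' = b then 1 else 0"] conjI TrueI)
  qed
  moreover have "\<forall>g. \<exists>c. g \<in> V \<longrightarrow> g = (\<lambda>x. \<Sum>b\<in>B. c b * b x)"
    unfolding V by blast
  ultimately show thesis
    using that[of B] \<open>finite B\<close> by (metis subsetI)
qed

lemma linear_endo_on_matrix:
  assumes L: "linear_endo_on V L" and "B \<subseteq> V"
    and coords: "\<And>g. g \<in> V \<Longrightarrow> g = (\<lambda>x. \<Sum>b\<in>B. c g b * b x)"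
  shows "L (\<lambda>x. \<Sum>b\<in>B. u b * b x) = (\<lambda>x. \<Sum>b'\<in>B. (\<Sum>b\<in>B. u b * c (L b) b') * b' x)"
proof
  fix x
  have "L (\<lambda>x. \<Sum>b\<in>B. u b * b x) x = (\<Sum>b\<in>B. u b * L b x)"
    by (simp add: linear_endo_on_sum[OF L])
  also have "\<dots> = (\<Sum>b\<in>B. u b * (\<Sum>b'\<in>B. c (L b) b' * b' x))"
  proof (rule sum.cong[OF refl])
    fix b assume "b \<in> B"
    then have "L b \<in> V" using assms(2) linear_endo_on_mem[OF L] by blast
    from fun_cong[OF coords[OF this]]
    show "u b * L b x = u b * (\<Sum>b'\<in>B. c (L b) b' * b' x)" by simp
  qed
  also have "\<dots> = (\<Sum>b'\<in>B. (\<Sum>b\<in>B. u b * c (L b) b') * b' x)"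
    unfolding sum_distrib_left sum_distrib_right by (subst sum.swap) (simp add: mult.assoc)
  finally show "L (\<lambda>x. \<Sum>b\<in>B. u b * b x) x = (\<Sum>b'\<in>B. (\<Sum>b\<in>B. u b * c (L b) b') * b' x)" .
qed

text \<open>The operators \<open>X \<mapsto> L n X (R n)\<close> live in the finite-dimensional space of endomorphisms of the
  endomorphisms of \<open>V\<close>, so the coefficients of a relation among them do not depend on \<open>X\<close>.\<close>
lemma fin_dim_subspace_sandwich_relation:
  fixes V :: "('a \<Rightarrow> real) set" and L R :: "nat \<Rightarrow> ('a \<Rightarrow> real) \<Rightarrow> 'a \<Rightarrow> real"
  assumes fin: "fin_dim_subspace V"
    and L: "\<And>n. linear_endo_on V (L n)" and R: "\<And>n. linear_endo_on V (R n)"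
  obtains I q m where "finite I" "m \<in> I" "q m \<noteq> 0"
    and "\<And>X g x. linear_endo_on V X \<Longrightarrow> g \<in> V \<Longrightarrow> (\<Sum>n\<in>I. q n * L n (X (R n g)) x) = 0"
proof -
  obtain B c where B: "finite B" "B \<subseteq> V"
    and coords: "\<And>g. g \<in> V \<Longrightarrow> g = (\<lambda>x. \<Sum>b\<in>B. c g b * b x)"
    by (rule fin_dim_subspace_coordinates[OF fin]) (rule that)
  note matrix = linear_endo_on_matrix[OF _ B(2) coords]
  define S where "S = B \<times> B \<times> B \<times> B"
  define a where "a n = (\<lambda>(b4, b3, b2, b1). c (R n b1) b2 * c (L n b3) b4)" for n
  define I where "I = {..card S}"
  have "finite S" "card S < card I"
    using B(1) by (simp_all add: S_def I_def)
  then obtain q m where "m \<in> I" "q m \<noteq> 0" and q: "\<And>s. s \<in> S \<Longrightarrow> (\<Sum>n\<in>I. q n * a n s) = 0"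
    using exists_nontrivial_linear_relation[of S I a] by (auto simp: I_def)
  have "(\<Sum>n\<in>I. q n * L n (X (R n g)) x) = 0" if X: "linear_endo_on V X" and g: "g \<in> V" for X g x
  proof -
    define e where "e = (\<lambda>(b4, b3, b2, b1). c g b1 * c (X b2) b3 * b4 x)"
    have "L n (X (R n g)) x = (\<Sum>s\<in>S. e s * a n s)" for n
    proof -
      have "L n (X (R n g)) x = (\<Sum>b4\<in>B. (\<Sum>b3\<in>B. (\<Sum>b2\<in>B. (\<Sum>b1\<in>B.
          c g b1 * c (R n b1) b2) * c (X b2) b3) * c (L n b3) b4) * b4 x)"
        by (subst coords[OF g]) (simp only: matrix[OF R] matrix[OF X] matrix[OF L])
      also have "\<dots> = (\<Sum>b4\<in>B. \<Sum>b3\<in>B. \<Sum>b2\<in>B. \<Sum>b1\<in>B.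
          (c g b1 * c (X b2) b3 * b4 x) * (c (R n b1) b2 * c (L n b3) b4))"
        unfolding sum_distrib_right by (simp add: mult_ac)
      also have "\<dots> = (\<Sum>s\<in>S. e s * a n s)"
        by (simp add: S_def e_def a_def sum.cartesian_product case_prod_beta')
      finally show ?thesis .
    qed
    then have "(\<Sum>n\<in>I. q n * L n (X (R n g)) x) = (\<Sum>s\<in>S. e s * (\<Sum>n\<in>I. q n * a n s))"
      unfolding sum_distrib_left by (subst sum.swap) (simp add: mult_ac sum_distrib_left)
    also have "\<dots> = 0" by (simp add: q)
    finally show ?thesis .
  qed
  then show thesis
    using that[of I m q] \<open>m \<in> I\<close> \<open>q m \<noteq> 0\<close> by (simp add: I_def)
qed

section \<open>Translations on an invariant space are unipotent\<close>

lemma invertible_matrix_inv: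
  fixes A :: "'a::semiring_1^'n^'m"
  assumes "invertible A"
  shows "A ** matrix_inv A = mat 1" "matrix_inv A ** A = mat 1"
  using someI_ex[OF assms[unfolded invertible_def]] by (auto simp: matrix_inv_def)

lemma matrix_inv_matrix_inv:
  fixes A :: "'a::semiring_1^'n^'m"
  assumes "invertible A"
  shows "matrix_inv (matrix_inv A) = A"
proof -
  note A = invertible_matrix_inv[OF assms]
  have "invertible (matrix_inv A)"
    using A by (auto simp: invertible_def)
  then have "A ** (matrix_inv A ** matrix_inv (matrix_inv A)) = A"
    by (simp add: invertible_matrix_inv)
  then show ?thesis
    by (simp add: matrix_mul_assoc A)
qed

locale equivariant_translations =
  fixes G :: "(real^'n^'n) set" and z0 :: "real^'n" and V :: "('a \<Rightarrow> real) set"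
    and T :: "real^'n \<Rightarrow> ('a \<Rightarrow> real) \<Rightarrow> 'a \<Rightarrow> real"
    and U :: "real^'n^'n \<Rightarrow> ('a \<Rightarrow> real) \<Rightarrow> 'a \<Rightarrow> real"
  assumes subgroup: "subgroup_GL G"
    and interior_Lambda: "interior (Lambda_set G z0) \<noteq> {}"
    and fin_dim: "fin_dim_subspace V"
    and T_endo: "linear_endo_on V (T h)"
    and U_endo: "P \<in> G \<Longrightarrow> linear_endo_on V (U P)"
    and T_T: "g \<in> V \<Longrightarrow> T h (T k g) = T (h + k) g"
    and U_T: "P \<in> G \<Longrightarrow> g \<in> V \<Longrightarrow> U P (T (P *v h) g) = T h (U P g)"
    and U_inv: "P \<in> G \<Longrightarrow> g \<in> V \<Longrightarrow> U (matrix_inv P) (U P g) = g"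
begin

lemma matrix_inv_mem: "P \<in> G \<Longrightarrow> matrix_inv P \<in> G"
  using subgroup by (simp add: subgroup_GL_def)

lemmas T_mem = linear_endo_on_mem[OF T_endo]
lemmas U_mem = linear_endo_on_mem[OF U_endo]

lemma U_inv_T_U: "P \<in> G \<Longrightarrow> g \<in> V \<Longrightarrow> U (matrix_inv P) (T h (U P g)) = T (P *v h) g"
  using U_T[of P g h] U_inv[of P "T (P *v h) g"] T_mem[of g "P *v h"] by simp

lemma T_Lambda_sandwich:
  assumes "P \<in> G" "Q \<in> G" "g \<in> V"
  shows "T (P *v h - Q *v h) g =
    U (matrix_inv P) (T h (U P (U (matrix_inv Q) (T (- h) (U Q g)))))"
  using assms by (simp add: U_inv_T_U T_mem T_T vec.neg)

lemma annihilating_relation: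
  obtains I :: "nat set" and q m where "finite I" "m \<in> I" "q m \<noteq> 0"
    and "\<And>h g x. h \<in> Lambda_set G z0 \<Longrightarrow> g \<in> V \<Longrightarrow> (\<Sum>n\<in>I. q n * T (real n *\<^sub>R h) g x) = 0"
proof -
  obtain I :: "nat set" and q m where I: "finite I" "m \<in> I" "q m \<noteq> 0"
    and sandwich: "\<And>X g x. linear_endo_on V X \<Longrightarrow> g \<in> V \<Longrightarrow>
      (\<Sum>n\<in>I. q n * T (real n *\<^sub>R z0) (X (T (- (real n *\<^sub>R z0)) g)) x) = 0"
    by (rule fin_dim_subspace_sandwich_relation[OF fin_dim,
      of "\<lambda>n. T (real n *\<^sub>R z0)" "\<lambda>n. T (- (real n *\<^sub>R z0))", OF T_endo T_endo]) (rule that)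
  have "(\<Sum>n\<in>I. q n * T (real n *\<^sub>R h) g x) = 0" if "h \<in> Lambda_set G z0" and g: "g \<in> V" for h g x
  proof -
    obtain P Q where P: "P \<in> G" and Q: "Q \<in> G" and h: "h = P *v z0 - Q *v z0"
      using \<open>h \<in> Lambda_set G z0\<close> by (auto simp: Lambda_set_def)
    note endo_inv = U_endo[OF matrix_inv_mem[OF P]] U_endo[OF matrix_inv_mem[OF Q]]
    define Y where
      "Y n = T (real n *\<^sub>R z0) (U P (U (matrix_inv Q) (T (- (real n *\<^sub>R z0)) (U Q g))))" for n
    have "real n *\<^sub>R h = P *v (real n *\<^sub>R z0) - Q *v (real n *\<^sub>R z0)" for n
      by (simp add: h matrix_vector_mult_scaleR scaleR_diff_right)
    then have "T (real n *\<^sub>R h) g = U (matrix_inv P) (Y n)" for n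
      using T_Lambda_sandwich[OF P Q g] by (simp add: Y_def)
    then have "(\<Sum>n\<in>I. q n * T (real n *\<^sub>R h) g x) = U (matrix_inv P) (\<lambda>x. \<Sum>n\<in>I. q n * Y n x) x"
      by (simp add: linear_endo_on_sum[OF endo_inv(1)])
    also have "(\<lambda>x. \<Sum>n\<in>I. q n * Y n x) = (\<lambda>_. 0)"
      using sandwich[OF linear_endo_on_comp[OF U_endo[OF P] endo_inv(2)] U_mem[OF Q g]]
      by (simp add: Y_def)
    also have "U (matrix_inv P) (\<lambda>_. 0) x = 0"
      using linear_endo_on_sum[OF endo_inv(1), where I = "{}"] by simp
    finally show ?thesis .
  qed
  then show thesis using that I by blast
qed

theorem orbits_generalized_polynomial:
  "\<exists>N. \<forall>g\<in>V. \<forall>x. generalized_polynomial N (\<lambda>y. T y g x)"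
proof -
  obtain I :: "nat set" and q m where I: "finite I" "m \<in> I" "q m \<noteq> 0"
    and rel: "\<And>h g x. h \<in> Lambda_set G z0 \<Longrightarrow> g \<in> V \<Longrightarrow> (\<Sum>n\<in>I. q n * T (real n *\<^sub>R h) g x) = 0"
    by (rule annihilating_relation) (rule that)
  have "generalized_polynomial (card (I - {m})) (\<lambda>y. T y g x)" if g: "g \<in> V" for g x
  proof -
    define f where "f n y = q n / q m * T y g x" for n y
    have "generalized_polynomial (card (I - {m})) (f m)"
    proof (rule generalized_polynomial_if_sum_dilates_eq_zero[OF _ _ open_interior interior_Lambda])
      fix y h assume "h \<in> interior (Lambda_set G z0)"
      then have h: "h \<in> Lambda_set G z0" using interior_subset by blast
      have "(\<Sum>n\<in>insert m (I - {m}). f n (y + real n *\<^sub>R h)) =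
          (\<Sum>n\<in>I. q n * T (real n *\<^sub>R h) (T y g) x) / q m"
        using I(2) by (simp add: f_def T_T[OF g] add.commute sum_divide_distrib insert_absorb)
      also have "\<dots> = 0"
        using rel[OF h T_mem[OF g]] by simp
      finally show "(\<Sum>n\<in>insert m (I - {m}). f n (y + real n *\<^sub>R h)) = 0" .
    qed (use I in auto)
    then show ?thesis using I(3) by (simp add: f_def[abs_def])
  qed
  then show ?thesis by blast
qed

end

section \<open>Smooth functions\<close>

declare pderivs.simps(2) [simp del]

definition has_partial_deriv :: "'n \<Rightarrow> (real^'n \<Rightarrow> real) \<Rightarrow> (real^'n \<Rightarrow> real) \<Rightarrow> bool" where
  "has_partial_deriv i f f' \<longleftrightarrow>
     (\<forall>x. ((\<lambda>t. f (x + t *\<^sub>R axis i 1)) has_real_derivative f' x) (at 0))"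

lemma has_partial_derivD:
  assumes "has_partial_deriv i f f'"
  shows "((\<lambda>t. f (x + t *\<^sub>R axis i 1)) has_real_derivative f' (x + s *\<^sub>R axis i 1)) (at s)"
proof -
  have "((\<lambda>t. f (x + s *\<^sub>R axis i 1 + t *\<^sub>R axis i 1)) has_real_derivative
      f' (x + s *\<^sub>R axis i 1)) (at (s + - s))"
    using assms by (simp add: has_partial_deriv_def)
  from DERIV_shift[THEN iffD1, OF this]
  show ?thesis by (simp add: algebra_simps)
qed

lemma has_partial_deriv_add:
  "has_partial_deriv i f f' \<Longrightarrow> has_partial_deriv i g g' \<Longrightarrow>
    has_partial_deriv i (\<lambda>x. f x + g x) (\<lambda>x. f' x + g' x)"
  by (simp add: has_partial_deriv_def DERIV_add)

lemma has_partial_deriv_mult: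
  "has_partial_deriv i f f' \<Longrightarrow> has_partial_deriv i g g' \<Longrightarrow>
    has_partial_deriv i (\<lambda>x. f x * g x) (\<lambda>x. f' x * g x + f x * g' x)"
  unfolding has_partial_deriv_def by (fastforce intro!: derivative_eq_intros)

lemma has_partial_deriv_sum_translates:
  assumes "\<And>k. k \<in> K \<Longrightarrow> has_partial_deriv i (f k) (f' k)"
  shows "has_partial_deriv i (\<lambda>x. \<Sum>k\<in>K. c k * f k (x - s k)) (\<lambda>x. \<Sum>k\<in>K. c k * f' k (x - s k))"
  unfolding has_partial_deriv_def
proof (intro allI DERIV_sum DERIV_cmult)
  fix x k assume "k \<in> K"
  from has_partial_derivD[OF assms[OF this], of "x - s k" 0]
  show "((\<lambda>t. f k (x + t *\<^sub>R axis i 1 - s k)) has_real_derivative f' k (x - s k)) (at 0)"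
    by (simp add: algebra_simps)
qed

lemma smooth_fun_continuous_pderivs: "smooth_fun g \<Longrightarrow> continuous_on UNIV (pderivs is g)"
  by (simp add: smooth_fun_def)

lemma smooth_fun_continuous: "smooth_fun g \<Longrightarrow> continuous_on UNIV g"
  using smooth_fun_continuous_pderivs[of g "[]"] by simp

lemma smooth_fun_has_partial_deriv:
  "smooth_fun g \<Longrightarrow> has_partial_deriv i (pderivs is g) (pderivs (i # is) g)"
  by (simp add: smooth_fun_def has_partial_deriv_def pderivs.simps(2)
      DERIV_deriv_iff_real_differentiable)

lemma
  assumes "H [] = g" and "\<And>is. continuous_on UNIV (H is)"
    and der: "\<And>is i. has_partial_deriv i (H is) (H (i # is))"
  shows smooth_funI: "smooth_fun g" and pderivs_eqI: "pderivs is g = H is"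
proof -
  have eq: "pderivs is g = H is" for "is"
  proof (induction "is")
    case (Cons i "is")
    show ?case
      using der DERIV_imp_deriv by (fastforce simp: pderivs.simps(2) Cons has_partial_deriv_def)
  qed (simp add: assms)
  then show "pderivs is g = H is" .
  show "smooth_fun g"
    using assms(2) der
    unfolding smooth_fun_def eq has_partial_deriv_def real_differentiable_def by blast
qed

lemma smooth_fun_coinduct:
  assumes "f \<in> A" and "\<And>f. f \<in> A \<Longrightarrow> continuous_on UNIV f"
    and "\<And>f i. f \<in> A \<Longrightarrow> \<exists>f'\<in>A. has_partial_deriv i f f'"
  shows "smooth_fun f"
proof -
  have "\<forall>i f. \<exists>f'. f \<in> A \<longrightarrow> f' \<in> A \<and> has_partial_deriv i f f'"
    using assms(3) by blast
  then obtain D where D: "\<And>i f. f \<in> A \<Longrightarrow> D i f \<in> A" "\<And>i f. f \<in> A \<Longrightarrow> has_partial_deriv i f (D i f)"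
    by metis
  have "foldr D is f \<in> A" for "is"
    by (induction "is") (auto simp: assms(1) D(1))
  then show ?thesis
    using assms(2) D(2) by (intro smooth_funI[of "\<lambda>is. foldr D is f"]) auto
qed

lemma smooth_fun_pderivs: "smooth_fun g \<Longrightarrow> smooth_fun (pderivs is g)"
  using smooth_fun_has_partial_deriv[of g _ "_ @ is"]
  by (intro smooth_funI[of "\<lambda>js. pderivs (js @ is) g"]) (auto simp: smooth_fun_continuous_pderivs)

lemma
  fixes \<phi> :: "'k \<Rightarrow> real^'n \<Rightarrow> real"
  assumes "\<And>k. k \<in> K \<Longrightarrow> smooth_fun (\<phi> k)"
  shows smooth_fun_sum_translates: "smooth_fun (\<lambda>x. \<Sum>k\<in>K. c k * \<phi> k (x - s k))"
    and pderivs_sum_translates: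
      "pderivs is (\<lambda>x. \<Sum>k\<in>K. c k * \<phi> k (x - s k)) = (\<lambda>x. \<Sum>k\<in>K. c k * pderivs is (\<phi> k) (x - s k))"
proof -
  let ?H = "\<lambda>is x. \<Sum>k\<in>K. c k * pderivs is (\<phi> k) (x - s k)"
  have start: "?H [] = (\<lambda>x. \<Sum>k\<in>K. c k * \<phi> k (x - s k))" by simp
  have cont: "continuous_on UNIV (?H is)" for "is"
    by (intro continuous_intros
        continuous_on_compose2[OF smooth_fun_continuous_pderivs[OF assms]]) auto
  have der: "has_partial_deriv i (?H is) (?H (i # is))" for "is" i
    by (intro has_partial_deriv_sum_translates smooth_fun_has_partial_deriv assms)
  show "smooth_fun (\<lambda>x. \<Sum>k\<in>K. c k * \<phi> k (x - s k))"
    by (rule smooth_funI[of ?H, OF start cont der])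
  show "pderivs is (\<lambda>x. \<Sum>k\<in>K. c k * \<phi> k (x - s k)) = ?H is"
    by (rule pderivs_eqI[of ?H, OF start cont der])
qed

definition sum_prods :: "(('a \<Rightarrow> real) \<times> ('a \<Rightarrow> real)) list \<Rightarrow> 'a \<Rightarrow> real" where
  "sum_prods ps x = (\<Sum>(a, b)\<leftarrow>ps. a x * b x)"

lemma continuous_on_sum_prods:
  "set ps \<subseteq> Collect (continuous_on A) \<times> Collect (continuous_on A) \<Longrightarrow> continuous_on A (sum_prods ps)"
  unfolding sum_prods_def[abs_def]
  by (induction ps) (auto intro!: continuous_on_add continuous_on_mult)

lemma has_partial_deriv_sum_prods:
  assumes "set ps \<subseteq> Collect smooth_fun \<times> Collect smooth_fun"
  shows "\<exists>qs. set qs \<subseteq> Collect smooth_fun \<times> Collect smooth_fun \<and>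
    has_partial_deriv i (sum_prods ps) (sum_prods qs)"
  using assms
proof (induction ps)
  case Nil
  then show ?case
    by (intro exI[of _ "[]"]) (simp add: sum_prods_def has_partial_deriv_def)
next
  case (Cons p ps)
  obtain a b where p: "p = (a, b)" by (cases p)
  have smooth: "smooth_fun a" "smooth_fun b" using Cons.prems p by auto
  obtain qs where qs: "set qs \<subseteq> Collect smooth_fun \<times> Collect smooth_fun"
    "has_partial_deriv i (sum_prods ps) (sum_prods qs)"
    using Cons by auto
  let ?rs = "(pderivs [i] a, b) # (a, pderivs [i] b) # qs"
  have "has_partial_deriv i (\<lambda>x. a x * b x)
      (\<lambda>x. pderivs [i] a x * b x + a x * pderivs [i] b x)"
    using smooth[THEN smooth_fun_has_partial_deriv, of i "[]"] by (simp add: has_partial_deriv_mult)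
  from has_partial_deriv_add[OF this qs(2)]
  have "has_partial_deriv i (sum_prods (p # ps)) (sum_prods ?rs)"
    by (simp add: sum_prods_def[abs_def] p add.assoc)
  moreover have "set ?rs \<subseteq> Collect smooth_fun \<times> Collect smooth_fun"
    using qs(1) smooth by (auto intro: smooth_fun_pderivs)
  ultimately show ?case by blast
qed

lemma smooth_fun_mult:
  assumes "smooth_fun a" "smooth_fun b"
  shows "smooth_fun (\<lambda>x. a x * b x)"
proof (rule smooth_fun_coinduct)
  let ?A = "sum_prods ` {ps. set ps \<subseteq> Collect smooth_fun \<times> Collect smooth_fun}"
  show "(\<lambda>x. a x * b x) \<in> ?A"
    using assms by (intro image_eqI[of _ _ "[(a, b)]"]) (auto simp: sum_prods_def[abs_def])
  show "continuous_on UNIV f" if "f \<in> ?A" for f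
    using that by (fastforce intro: continuous_on_sum_prods smooth_fun_continuous)
  show "\<exists>f'\<in>?A. has_partial_deriv i f f'" if "f \<in> ?A" for f i
    using that has_partial_deriv_sum_prods by blast
qed

lemma has_real_derivative_diagonal:
  fixes F :: "real \<Rightarrow> real \<Rightarrow> real"
  assumes fst: "((\<lambda>s. F s x) has_real_derivative D) (at x)"
    and snd: "\<And>s t. (F s has_real_derivative F' s t) (at t)"
    and cont: "continuous_on UNIV (\<lambda>z. F' (fst z) (snd z))"
  shows "((\<lambda>t. F t t) has_real_derivative D + F' x x) (at x)"
proof -
  have "((\<lambda>s. F s x) has_derivative (*) D) (at x within UNIV)"
    using fst by (simp add: has_field_derivative_def)
  moreover have "(F s has_derivative blinfun_mult_right (F' s t)) (at t within UNIV)" for s t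
    using snd by (simp add: has_field_derivative_def)
  moreover have "continuous (at (x, x) within UNIV \<times> UNIV) (\<lambda>(s, t). blinfun_mult_right (F' s t))"
    using bounded_linear.continuous_on[OF bounded_linear_blinfun_mult_right cont]
    by (simp add: case_prod_beta' continuous_on_eq_continuous_at)
  ultimately have "((\<lambda>(s, t). F s t) has_derivative (\<lambda>(s, t). D * s + F' x x * t)) (at (x, x))"
    using has_derivative_partialsI[where f = F and X = UNIV and Y = UNIV and x = x and y = x
        and fx = "(*) D" and fy = "\<lambda>s t. blinfun_mult_right (F' s t)"] by simp
  from has_derivative_compose[OF
      has_derivative_Pair[OF has_derivative_ident has_derivative_ident] this]
  show ?thesis
    by (simp add: has_field_derivative_def flip: distrib_right)
qed

lemma smooth_fun_directional_derivative:
  fixes g :: "real^'n \<Rightarrow> real"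
  assumes g: "smooth_fun g"
  shows "((\<lambda>t. g (x + t *\<^sub>R v)) has_real_derivative (\<Sum>j\<in>UNIV. v $ j * pderivs [j] g x)) (at 0)"
proof -
  define w where "w S = (\<Sum>j\<in>S. v $ j *\<^sub>R axis j (1::real))" for S :: "'n set"
  have partial_sum: "((\<lambda>t. g (x + t *\<^sub>R w S)) has_real_derivative
      (\<Sum>j\<in>S. v $ j * pderivs [j] g x)) (at 0)" for S
  proof (induction S rule: infinite_finite_induct)
    case (insert i S)
    define F where "F s t = g (x + s *\<^sub>R w S + (t * v $ i) *\<^sub>R axis i 1)" for s t
    define F' where "F' s t = pderivs [i] g (x + s *\<^sub>R w S + (t * v $ i) *\<^sub>R axis i 1) * v $ i"
      for s t
    have "((\<lambda>t. F t t) has_real_derivative (\<Sum>j\<in>S. v $ j * pderivs [j] g x) + F' 0 0) (at 0)"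
    proof (rule has_real_derivative_diagonal[where F = F and F' = F'])
      show "((\<lambda>s. F s 0) has_real_derivative (\<Sum>j\<in>S. v $ j * pderivs [j] g x)) (at 0)"
        using insert.IH by (simp add: F_def)
      show "(F s has_real_derivative F' s t) (at t)" for s t
      proof -
        have "((\<lambda>r. g (x + s *\<^sub>R w S + r *\<^sub>R axis i 1)) has_real_derivative
            pderivs [i] g (x + s *\<^sub>R w S + (t * v $ i) *\<^sub>R axis i 1)) (at (t * v $ i))"
          using has_partial_derivD[OF smooth_fun_has_partial_deriv[OF g, of i "[]"]] by simp
        moreover have "((\<lambda>t. t * v $ i) has_real_derivative v $ i) (at t)"
          by (auto intro!: derivative_eq_intros)
        ultimately show ?thesis
          unfolding F_def[abs_def] F'_def by (rule DERIV_chain2)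
      qed
      show "continuous_on UNIV (\<lambda>z. F' (fst z) (snd z))"
        unfolding F'_def
        by (intro continuous_intros
            continuous_on_compose2[OF smooth_fun_continuous_pderivs[OF g]]) auto
    qed
    moreover have "F t t = g (x + t *\<^sub>R w (insert i S))" for t
      using insert.hyps by (simp add: F_def w_def algebra_simps)
    ultimately show ?case
      using insert.hyps by (simp add: F'_def algebra_simps)
  qed (simp_all add: w_def)
  have "w UNIV = v"
    unfolding w_def using basis_expansion[of v] by (simp add: scalar_mult_eq_scaleR)
  then show ?thesis using partial_sum[of UNIV] by simp
qed

lemma smooth_fun_linear:
  fixes a :: "real^'m \<Rightarrow> real" and L :: "real^'n \<Rightarrow> real^'m"
  assumes "smooth_fun a" "linear L"
  shows "smooth_fun (\<lambda>x. a (L x))"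
proof (rule smooth_fun_coinduct)
  let ?A = "{\<lambda>x. a (L x) | a. smooth_fun a}"
  show "(\<lambda>x. a (L x)) \<in> ?A"
    using assms(1) by blast
  have "continuous_on UNIV L"
    using assms(2) by (simp add: linear_continuous_on linear_conv_bounded_linear)
  then show "continuous_on UNIV f" if "f \<in> ?A" for f
    using that continuous_on_compose2[OF smooth_fun_continuous] by blast
  fix f i assume "f \<in> ?A"
  then obtain a where f: "f = (\<lambda>x. a (L x))" and a: "smooth_fun a" by blast
  define a' where "a' y = (\<Sum>j\<in>UNIV. L (axis i 1) $ j * pderivs [j] a y)" for y
  have "smooth_fun a'"
    using smooth_fun_sum_translates[of UNIV "\<lambda>j. pderivs [j] a" _ "\<lambda>_. 0"] a
    by (simp add: a'_def[abs_def] smooth_fun_pderivs)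
  moreover have "has_partial_deriv i f (\<lambda>x. a' (L x))"
    unfolding has_partial_deriv_def f a'_def
    using smooth_fun_directional_derivative[OF a, of "L _" "L (axis i 1)"]
    by (simp add: linear_add[OF assms(2)] linear_cmul[OF assms(2)])
  ultimately show "\<exists>f'\<in>?A. has_partial_deriv i f f'" by blast
qed

section \<open>Test functions\<close>

abbreviation support :: "('a \<Rightarrow> 'b::zero) \<Rightarrow> 'a set" where
  "support f \<equiv> {x. f x \<noteq> 0}"

lemma bounded_support_mult:
  fixes f g :: "'a::metric_space \<Rightarrow> 'b::mult_zero"
  assumes "bounded (support f)"
  shows "bounded (support (\<lambda>x. f x * g x))"
  by (rule bounded_subset[OF assms]) auto

lemma pderivs_support_subset: "support (pderivs is \<phi>) \<subseteq> closure (support \<phi>)"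
proof (induction "is")
  case (Cons i "is")
  have "pderivs (i # is) \<phi> x = 0" if "x \<notin> closure (support \<phi>)" for x
  proof -
    have "((\<lambda>t. x + t *\<^sub>R axis i 1) \<longlongrightarrow> x + 0 *\<^sub>R axis i 1) (nhds 0)"
      by (intro tendsto_intros filterlim_ident)
    then have "\<forall>\<^sub>F t in nhds 0. x + t *\<^sub>R axis i 1 \<in> - closure (support \<phi>)"
      using that by (intro topological_tendstoD) auto
    then have "\<forall>\<^sub>F t in nhds 0. pderivs is \<phi> (x + t *\<^sub>R axis i 1) = 0"
      using Cons by (auto elim!: eventually_mono)
    from deriv_cong_ev[OF this refl] show ?thesis by (simp add: pderivs.simps(2))
  qed
  then show ?case by blast
qed (simp add: closure_subset)

lemma test_fun_iff: "test_fun \<phi> \<longleftrightarrow> smooth_fun \<phi> \<and> bounded (support \<phi>)"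
  by (simp add: test_fun_def)

lemma test_fun_smooth: "test_fun \<phi> \<Longrightarrow> smooth_fun \<phi>"
  and test_fun_bounded_support: "test_fun \<phi> \<Longrightarrow> bounded (support \<phi>)"
  by (simp_all add: test_fun_iff)

lemma test_fun_pderivs_bounded_support: "test_fun \<phi> \<Longrightarrow> bounded (support (pderivs is \<phi>))"
  using bounded_closure[OF test_fun_bounded_support] bounded_subset pderivs_support_subset by blast

lemmas test_fun_continuous = smooth_fun_continuous[OF test_fun_smooth]
lemmas test_fun_continuous_pderivs = smooth_fun_continuous_pderivs[OF test_fun_smooth]

lemma test_fun_sum_translates:
  fixes \<phi> :: "'k \<Rightarrow> real^'n \<Rightarrow> real"
  assumes "\<And>k. k \<in> K \<Longrightarrow> test_fun (\<phi> k)"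
  shows "test_fun (\<lambda>x. \<Sum>k\<in>K. c k * \<phi> k (x - s k))"
proof (cases "finite K")
  case True
  have "support (\<lambda>x. \<Sum>k\<in>K. c k * \<phi> k (x - s k)) \<subseteq> (\<Union>k\<in>K. (+) (s k) ` support (\<phi> k))"
  proof
    fix x assume "x \<in> support (\<lambda>x. \<Sum>k\<in>K. c k * \<phi> k (x - s k))"
    then obtain k where "k \<in> K" "\<phi> k (x - s k) \<noteq> 0"
      by (auto elim: sum.not_neutral_contains_not_neutral)
    then show "x \<in> (\<Union>k\<in>K. (+) (s k) ` support (\<phi> k))"
      by (intro UN_I[of k] image_eqI[of _ _ "x - s k"]) auto
  qed
  moreover have "bounded (\<Union>k\<in>K. (+) (s k) ` support (\<phi> k))"
    using True assms by (auto intro!: bounded_translation test_fun_bounded_support)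
  ultimately show ?thesis
    using assms by (simp add: test_fun_iff smooth_fun_sum_translates bounded_subset)
qed (use smooth_fun_sum_translates[of "{}" \<phi> c s] in \<open>simp add: test_fun_iff\<close>)

lemma test_fun_sum:
  "(\<And>k. k \<in> K \<Longrightarrow> test_fun (\<phi> k)) \<Longrightarrow> test_fun (\<lambda>x. \<Sum>k\<in>K. c k * \<phi> k x)"
  using test_fun_sum_translates[of K \<phi> c "\<lambda>_. 0"] by simp

lemma test_fun_translate: "test_fun \<phi> \<Longrightarrow> test_fun (\<lambda>x. \<phi> (x - h))"
  using test_fun_sum_translates[of "{()}" "\<lambda>_. \<phi>" "\<lambda>_. 1" "\<lambda>_. h"] by simp

lemma pderivs_translate:
  "test_fun \<phi> \<Longrightarrow> pderivs is (\<lambda>x. \<phi> (x - h)) = (\<lambda>x. pderivs is \<phi> (x - h))"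
  using pderivs_sum_translates[of "{()}" "\<lambda>_. \<phi>" "is" "\<lambda>_. 1" "\<lambda>_. h"]
  by (simp add: test_fun_smooth)

lemma
  assumes "test_fun \<phi>" "test_fun \<psi>"
  shows test_fun_diff: "test_fun (\<lambda>x. \<phi> x - \<psi> x)"
    and pderivs_diff: "pderivs is (\<lambda>x. \<phi> x - \<psi> x) = (\<lambda>x. pderivs is \<phi> x - pderivs is \<psi> x)"
proof -
  let ?c = "\<lambda>k. if k then 1 else - 1 :: real" and ?f = "\<lambda>k. if k then \<phi> else \<psi>"
  have diff: "(\<lambda>x. \<phi> x - \<psi> x) = (\<lambda>x. \<Sum>k\<in>UNIV. ?c k * ?f k (x - 0))"
    by (simp add: UNIV_bool)
  show "test_fun (\<lambda>x. \<phi> x - \<psi> x)"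
    unfolding diff by (rule test_fun_sum_translates) (use assms in auto)
  show "pderivs is (\<lambda>x. \<phi> x - \<psi> x) = (\<lambda>x. pderivs is \<phi> x - pderivs is \<psi> x)"
    unfolding diff
    by (subst pderivs_sum_translates) (use assms test_fun_smooth in \<open>auto simp: UNIV_bool\<close>)
qed

lemma test_fun_mult:
  assumes "test_fun a" "test_fun b"
  shows "test_fun (\<lambda>x. a x * b x)"
  using assms by (simp only: test_fun_iff smooth_fun_mult bounded_support_mult)

lemma test_fun_linear:
  fixes L :: "real^'n \<Rightarrow> real^'m"
  assumes "test_fun \<phi>" "linear L" "inj L"
  shows "test_fun (\<lambda>x. \<phi> (L x))"
proof -
  obtain B where "B > 0" and B: "\<And>x. B * norm x \<le> norm (L x)"
    using linear_inj_bounded_below_pos[OF assms(2,3)] by blast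
  obtain M where M: "\<And>y. \<phi> y \<noteq> 0 \<Longrightarrow> norm y \<le> M"
    using test_fun_bounded_support[OF assms(1)] by (auto simp: bounded_iff)
  have "norm x \<le> M / B" if "\<phi> (L x) \<noteq> 0" for x
    using B[of x] M[OF that] \<open>B > 0\<close> by (simp add: field_simps)
  then have "bounded (support (\<lambda>x. \<phi> (L x)))"
    by (auto simp: bounded_iff)
  then show ?thesis
    using assms by (simp add: test_fun_iff smooth_fun_linear)
qed

lemma test_fun_matrix:
  fixes A :: "real^'n^'n"
  assumes "test_fun \<phi>" "invertible A"
  shows "test_fun (\<lambda>x. \<phi> (A *v x))"
  using assms(1) matrix_vector_mul_linear inj_matrix_vector_mult[OF assms(2)]
  by (rule test_fun_linear)

lemma test_fun_dilate:
  assumes "test_fun \<phi>" "r \<noteq> 0"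
  shows "test_fun (\<lambda>x. \<phi> (r *\<^sub>R x))"
  using assms
  by (intro test_fun_linear[of _ "(*\<^sub>R) r"]) (auto simp: linear_iff scaleR_right_distrib inj_def)

section \<open>Continuous functions of bounded support\<close>

lemma integral_UNIV_eq_integral:
  fixes g :: "'a::euclidean_space \<Rightarrow> 'b::banach"
  assumes "support g \<subseteq> S"
  shows "integral UNIV g = integral S g"
proof -
  have "g = (\<lambda>y. if y \<in> S then g y else 0)" using assms by (intro ext) auto
  then show ?thesis by (metis integral_restrict_UNIV)
qed

lemma has_integral_cbox_if_support_subset:
  fixes g :: "'a::euclidean_space \<Rightarrow> 'b::banach"
  assumes "continuous_on UNIV g" "support g \<subseteq> cbox a b"
  shows "(g has_integral integral UNIV g) (cbox a b)"
  unfolding integral_UNIV_eq_integral[OF assms(2)]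
  using assms(1)
  by (intro integrable_integral integrable_continuous) (auto intro: continuous_on_subset)

lemma integrable_on_UNIV_if_bounded_support:
  fixes g :: "'a::euclidean_space \<Rightarrow> 'b::banach"
  assumes "continuous_on UNIV g" "bounded (support g)"
  shows "g integrable_on UNIV"
proof -
  obtain a where a: "support g \<subseteq> cbox (- a) a"
    using bounded_subset_cbox_symmetric[OF assms(2)] .
  have "(g has_integral integral UNIV g) UNIV"
    using has_integral_cbox_if_support_subset[OF assms(1) a]
    by (rule has_integral_on_superset) (use a in auto)
  then show ?thesis by blast
qed

lemma integral_UNIV_affine:
  fixes g :: "'a::euclidean_space \<Rightarrow> real"
  assumes g: "continuous_on UNIV g" "bounded (support g)" and m: "m \<noteq> 0"
  shows "integral UNIV (\<lambda>y. g (m *\<^sub>R y + c)) = integral UNIV g / \<bar>m\<bar> ^ DIM('a)"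
proof -
  obtain a where a: "support g \<subseteq> cbox (- a) a"
    using bounded_subset_cbox_symmetric[OF g(2)] .
  let ?inv = "\<lambda>x. (1 / m) *\<^sub>R x + - ((1 / m) *\<^sub>R c)"
  from has_integral_affinity[OF has_integral_cbox_if_support_subset[OF g(1) a] m, of c]
  have "((\<lambda>y. g (m *\<^sub>R y + c)) has_integral (1 / \<bar>m\<bar> ^ DIM('a)) *\<^sub>R integral UNIV g)
      (?inv ` cbox (- a) a)" .
  moreover have "g (m *\<^sub>R y + c) = 0" if "y \<notin> ?inv ` cbox (- a) a" for y
  proof -
    have "y = ?inv (m *\<^sub>R y + c)" using m by (simp add: scaleR_add_right)
    then have "m *\<^sub>R y + c \<notin> cbox (- a) a" using that by blast
    then show ?thesis using a by blast
  qed
  ultimately have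
    "((\<lambda>y. g (m *\<^sub>R y + c)) has_integral (1 / \<bar>m\<bar> ^ DIM('a)) *\<^sub>R integral UNIV g) UNIV"
    by (rule has_integral_on_superset) auto
  then show ?thesis by (simp add: integral_unique)
qed

lemma bounded_range_bounded_support:
  fixes g :: "'a::heine_borel \<Rightarrow> 'b::real_normed_vector"
  assumes "continuous_on UNIV g" "bounded (support g)"
  shows "bounded (range g)"
proof -
  have "compact (g ` closure (support g))"
    using assms by (intro compact_continuous_image) (auto intro: continuous_on_subset)
  then have "bounded (insert 0 (g ` closure (support g)))"
    by (simp add: compact_imp_bounded)
  moreover have "g x \<in> insert 0 (g ` closure (support g))" for x
    using closure_subset[of "support g"] by (cases "g x = 0") auto
  ultimately show ?thesis
    by (meson bounded_subset image_subsetI)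
qed

lemma uniformly_continuous_on_bounded_support:
  fixes g :: "'a::heine_borel \<Rightarrow> 'b::real_normed_vector"
  assumes g: "continuous_on UNIV g" "bounded (support g)"
  shows "uniformly_continuous_on UNIV g"
  unfolding uniformly_continuous_on_def
proof (intro allI impI)
  fix e :: real assume "e > 0"
  obtain a r where r: "support g \<subseteq> cball a r"
    using g(2) unfolding bounded_subset_cball by blast
  have "uniformly_continuous_on (cball a (r + 1)) g"
    using g(1)
    by (intro compact_uniformly_continuous compact_cball) (auto intro: continuous_on_subset)
  then obtain d where d: "d > 0"
    "\<And>x y. x \<in> cball a (r + 1) \<Longrightarrow> y \<in> cball a (r + 1) \<Longrightarrow> dist y x < d \<Longrightarrow> dist (g y) (g x) < e"
    using \<open>e > 0\<close> unfolding uniformly_continuous_on_def by metis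
  have "dist (g y) (g x) < e" if "dist y x < min d 1" for x y
  proof (cases "x \<in> cball a (r + 1) \<and> y \<in> cball a (r + 1)")
    case True
    then show ?thesis using d(2) that by simp
  next
    case False
    then have "\<not> dist a x \<le> r" "\<not> dist a y \<le> r"
      using that dist_triangle[of a x y] dist_triangle[of a y x] by (auto simp: dist_commute)
    then have "g x = 0" "g y = 0" using r by auto
    then show ?thesis using \<open>e > 0\<close> by simp
  qed
  then show "\<exists>d>0. \<forall>x\<in>UNIV. \<forall>y\<in>UNIV. dist y x < d \<longrightarrow> dist (g y) (g x) < e"
    using d(1) by (intro exI[of _ "min d 1"]) auto
qed

lemma uniform_limit_translates:
  fixes g :: "'a::real_normed_vector \<Rightarrow> 'b::metric_space"
  assumes "uniformly_continuous_on UNIV g"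
  shows "uniform_limit UNIV (\<lambda>z x. g (x - z)) (\<lambda>x. g (x - y)) (at y)"
proof (rule uniform_limitI)
  fix e :: real assume "e > 0"
  then obtain d where d: "d > 0" "\<And>x y. dist y x < d \<Longrightarrow> dist (g y) (g x) < e"
    using assms unfolding uniformly_continuous_on_def by (metis UNIV_I)
  have "\<forall>\<^sub>F z in at y. dist z y < d"
    using d(1) by (auto simp: eventually_at)
  then show "\<forall>\<^sub>F z in at y. \<forall>x\<in>UNIV. dist (g (x - z)) (g (x - y)) < e"
    by eventually_elim (auto intro!: d(2) simp: dist_norm norm_minus_commute)
qed

instance bcontfun :: (metric_space, banach) banach ..

lemma uniform_limit_riemann_sums:
  fixes G :: "'a::euclidean_space \<Rightarrow> 'x::metric_space \<Rightarrow>\<^sub>C 'b::banach"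
  assumes "continuous_on (cbox a b) G"
  shows "uniform_limit UNIV (\<lambda>p x. \<Sum>(t, k)\<in>p. measure lborel k *\<^sub>R G t x)
    (\<lambda>x. integral (cbox a b) (\<lambda>t. G t x)) (division_filter (cbox a b))"
proof -
  have eval: "bounded_linear (\<lambda>g :: 'x \<Rightarrow>\<^sub>C 'b. apply_bcontfun g x)" for x
    using norm_bounded by (intro bounded_linear_intro[where K = 1]) auto
  have "(G has_integral integral (cbox a b) G) (cbox a b)"
    using assms by (intro integrable_integral integrable_continuous)
  then have "((\<lambda>p. \<Sum>(t, k)\<in>p. measure lborel k *\<^sub>R G t) \<longlongrightarrow> integral (cbox a b) G)
      (division_filter (cbox a b))"
    by (simp only: has_integral_cbox)
  from tendsto_bcontfun_uniform_limit[OF this]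
  have "uniform_limit UNIV (\<lambda>p. apply_bcontfun (\<Sum>(t, k)\<in>p. measure lborel k *\<^sub>R G t))
      (apply_bcontfun (integral (cbox a b) G)) (division_filter (cbox a b))" .
  moreover have "apply_bcontfun (\<Sum>(t, k)\<in>p. measure lborel k *\<^sub>R G t) =
      (\<lambda>x. \<Sum>(t, k)\<in>p. measure lborel k *\<^sub>R G t x)"
    for p :: "('a \<times> 'a set) set"
    by (simp add: linear_sum[OF bounded_linear.linear[OF eval]] case_prod_beta' fun_eq_iff)
  moreover have "apply_bcontfun (integral (cbox a b) G) = (\<lambda>x. integral (cbox a b) (\<lambda>t. G t x))"
    using integral_linear[OF integrable_continuous[OF assms] eval] by (simp add: o_def fun_eq_iff)
  ultimately show ?thesis by simp
qed

section \<open>Convolution\<close>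

definition conv :: "('a::euclidean_space \<Rightarrow> real) \<Rightarrow> ('a \<Rightarrow> real) \<Rightarrow> 'a \<Rightarrow> real" where
  "conv \<psi> \<kappa> x = integral UNIV (\<lambda>y. \<psi> y * \<kappa> (x - y))"

lemma conv_commute:
  assumes "continuous_on UNIV \<psi>" "bounded (support \<psi>)" "continuous_on UNIV \<kappa>"
  shows "conv \<psi> \<kappa> = conv \<kappa> \<psi>"
proof
  fix x
  have "continuous_on UNIV (\<lambda>y. \<psi> y * \<kappa> (x - y))"
    by (intro continuous_intros continuous_on_compose2[OF assms(3)] assms(1)) auto
  moreover have "bounded (support (\<lambda>y. \<psi> y * \<kappa> (x - y)))"
    using assms(2) by (rule bounded_support_mult)
  ultimately show "conv \<psi> \<kappa> x = conv \<kappa> \<psi> x"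
    using integral_UNIV_affine[of "\<lambda>y. \<psi> y * \<kappa> (x - y)" "-1" x] by (simp add: conv_def mult.commute)
qed

lemma bounded_set_plus:
  fixes S T :: "'a::real_normed_vector set"
  assumes "bounded S" "bounded T"
  shows "bounded (S + T)"
  using bounded_plus[OF assms] by (simp add: set_plus_image)

lemma mem_set_plusI: "y \<in> S \<Longrightarrow> x - y \<in> T \<Longrightarrow> x \<in> S + T"
  for x :: "'a::ab_group_add"
  using set_plus_intro[of y S "x - y" T] by simp

lemma conv_support_subset: "support (conv \<psi> \<kappa>) \<subseteq> support \<psi> + support \<kappa>"
proof
  fix x assume x: "x \<in> support (conv \<psi> \<kappa>)"
  have "\<exists>y. \<psi> y * \<kappa> (x - y) \<noteq> 0"
  proof (rule ccontr)
    assume "\<nexists>y. \<psi> y * \<kappa> (x - y) \<noteq> 0"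
    then have "\<psi> y * \<kappa> (x - y) = 0" for y by blast
    then have "conv \<psi> \<kappa> x = 0" by (simp only: conv_def integral_0)
    then show False using x by simp
  qed
  then show "x \<in> support \<psi> + support \<kappa>"
    by (auto intro: mem_set_plusI)
qed

lemma conv_eq_integral_cbox:
  assumes "support \<psi> \<subseteq> cbox a b"
  shows "conv \<psi> \<kappa> = (\<lambda>x. integral (cbox a b) (\<lambda>y. \<psi> y * \<kappa> (x - y)))"
  unfolding conv_def[abs_def] using assms by (intro ext integral_UNIV_eq_integral) auto

lemma continuous_on_conv:
  assumes "continuous_on UNIV \<psi>" "bounded (support \<psi>)" "continuous_on UNIV \<kappa>"
  shows "continuous_on UNIV (conv \<psi> \<kappa>)"
proof -
  obtain a where a: "support \<psi> \<subseteq> cbox (- a) a"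
    using bounded_subset_cbox_symmetric[OF assms(2)] .
  show ?thesis
    unfolding conv_eq_integral_cbox[OF a]
    by (intro integral_continuous_on_param)
      (auto simp: case_prod_beta' intro!: continuous_intros
        continuous_on_compose2[OF assms(1)] continuous_on_compose2[OF assms(3)])
qed

lemma has_partial_deriv_conv:
  fixes \<psi> \<kappa> :: "real^'n \<Rightarrow> real"
  assumes \<psi>: "continuous_on UNIV \<psi>" "bounded (support \<psi>)"
    and \<kappa>: "continuous_on UNIV \<kappa>" "continuous_on UNIV \<kappa>'" "has_partial_deriv i \<kappa> \<kappa>'"
  shows "has_partial_deriv i (conv \<psi> \<kappa>) (conv \<psi> \<kappa>')"
  unfolding has_partial_deriv_def
proof
  fix x :: "real^'n"
  obtain a where a: "support \<psi> \<subseteq> cbox (- a) a"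
    using bounded_subset_cbox_symmetric[OF \<psi>(2)] .
  note cont_intros = continuous_intros continuous_on_compose2[OF \<psi>(1)]
    continuous_on_compose2[OF \<kappa>(1)] continuous_on_compose2[OF \<kappa>(2)]
  let ?arg = "\<lambda>t y. x + t *\<^sub>R axis i 1 - y"
  have "((\<lambda>t. integral (cbox (- a) a) (\<lambda>y. \<psi> y * \<kappa> (?arg t y))) has_real_derivative
    integral (cbox (- a) a) (\<lambda>y. \<psi> y * \<kappa>' (?arg 0 y))) (at 0 within UNIV)"
  proof (rule leibniz_rule_field_derivative[where fx = "\<lambda>t y. \<psi> y * \<kappa>' (?arg t y)"])
    fix t and y :: "real^'n"
    have "((\<lambda>t. \<kappa> (?arg t y)) has_real_derivative \<kappa>' (?arg t y)) (at t)"
      using has_partial_derivD[OF \<kappa>(3), of "x - y" t] by (simp add: algebra_simps)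
    then show "((\<lambda>t. \<psi> y * \<kappa> (?arg t y)) has_real_derivative \<psi> y * \<kappa>' (?arg t y))
        (at t within UNIV)"
      by (rule DERIV_cmult)
    show "(\<lambda>y. \<psi> y * \<kappa> (?arg t y)) integrable_on cbox (- a) a"
      by (intro integrable_continuous cont_intros) auto
  next
    show "continuous_on (UNIV \<times> cbox (- a) a) (\<lambda>(t, y). \<psi> y * \<kappa>' (?arg t y))"
      unfolding case_prod_beta' by (intro cont_intros) auto
  qed auto
  then show "((\<lambda>t. conv \<psi> \<kappa> (x + t *\<^sub>R axis i 1)) has_real_derivative conv \<psi> \<kappa>' x) (at 0)"
    by (simp add: conv_eq_integral_cbox[OF a])
qed

lemma
  fixes \<psi> \<kappa> :: "real^'n \<Rightarrow> real"
  assumes \<psi>: "continuous_on UNIV \<psi>" "bounded (support \<psi>)" and \<kappa>: "smooth_fun \<kappa>"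
  shows smooth_fun_conv: "smooth_fun (conv \<psi> \<kappa>)"
    and pderivs_conv: "pderivs is (conv \<psi> \<kappa>) = conv \<psi> (pderivs is \<kappa>)"
proof -
  let ?H = "\<lambda>is. conv \<psi> (pderivs is \<kappa>)"
  have start: "?H [] = conv \<psi> \<kappa>" by simp
  have cont: "continuous_on UNIV (?H is)" for "is"
    by (intro continuous_on_conv \<psi> smooth_fun_continuous_pderivs \<kappa>)
  have der: "has_partial_deriv i (?H is) (?H (i # is))" for "is" i
    by (intro has_partial_deriv_conv \<psi> smooth_fun_continuous_pderivs smooth_fun_has_partial_deriv \<kappa>)
  show "smooth_fun (conv \<psi> \<kappa>)"
    by (rule smooth_funI[of ?H, OF start cont der])
  show "pderivs is (conv \<psi> \<kappa>) = ?H is"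
    by (rule pderivs_eqI[of ?H, OF start cont der])
qed

lemma test_fun_conv:
  fixes \<psi> \<kappa> :: "real^'n \<Rightarrow> real"
  assumes "continuous_on UNIV \<psi>" "bounded (support \<psi>)" "test_fun \<kappa>"
  shows "test_fun (conv \<psi> \<kappa>)"
proof -
  have "bounded (support \<psi> + support \<kappa>)"
    by (intro bounded_set_plus assms(2) test_fun_bounded_support assms(3))
  then have "bounded (support (conv \<psi> \<kappa>))"
    using conv_support_subset by (rule bounded_subset)
  then show ?thesis
    using assms by (simp add: test_fun_iff smooth_fun_conv)
qed

section \<open>Distributions\<close>

lemma distribution_linear:
  assumes "distribution f" "test_fun \<phi>" "test_fun \<psi>"
  shows "f (\<lambda>x. a * \<phi> x + b * \<psi> x) = a * f \<phi> + b * f \<psi>"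
  using assms by (simp add: distribution_def)

lemma distribution_diff:
  assumes "distribution f" "test_fun \<phi>" "test_fun \<psi>"
  shows "f (\<lambda>x. \<phi> x - \<psi> x) = f \<phi> - f \<psi>"
  using distribution_linear[OF assms, of 1 "-1"] by simp

lemma distribution_zero:
  assumes "distribution f"
  shows "f (\<lambda>_. 0) = 0"
proof -
  have "test_fun (\<lambda>_. 0)" using test_fun_sum[of "{}"] by simp
  from distribution_diff[OF assms this this] show ?thesis by simp
qed

lemma distribution_sum:
  assumes f: "distribution f" and "\<And>k. k \<in> K \<Longrightarrow> test_fun (\<phi> k)"
  shows "f (\<lambda>x. \<Sum>k\<in>K. c k * \<phi> k x) = (\<Sum>k\<in>K. c k * f (\<phi> k))"
  using assms(2)
proof (induction K rule: infinite_finite_induct)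
  case (insert k K)
  have "test_fun (\<lambda>x. \<Sum>k\<in>K. c k * \<phi> k x)" by (rule test_fun_sum) (use insert in auto)
  from distribution_linear[OF f insert.prems[of k] this, of "c k" 1]
  show ?case using insert by simp
qed (simp_all add: distribution_zero[OF f])

lemma tendsto_SUP_abs_zero:
  fixes h :: "'i \<Rightarrow> 'x \<Rightarrow> real"
  assumes "uniform_limit UNIV h (\<lambda>_. 0) F"
  shows "((\<lambda>n. SUP x. \<bar>h n x\<bar>) \<longlongrightarrow> 0) F"
proof (rule tendstoI)
  fix e :: real assume "e > 0"
  then have "\<forall>\<^sub>F n in F. \<forall>x\<in>UNIV. dist (h n x) 0 < e / 2"
    using assms by (intro uniform_limitD) auto
  then show "\<forall>\<^sub>F n in F. dist (SUP x. \<bar>h n x\<bar>) 0 < e"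
  proof eventually_elim
    case (elim n)
    then have bound: "\<bar>h n x\<bar> \<le> e / 2" for x by (simp add: less_imp_le)
    then have "(SUP x. \<bar>h n x\<bar>) \<le> e / 2" by (intro cSUP_least) auto
    moreover have "\<bar>h n undefined\<bar> \<le> (SUP x. \<bar>h n x\<bar>)"
      using bound by (intro cSUP_upper bdd_aboveI2[where M = "e / 2"]) auto
    ultimately show ?case using \<open>e > 0\<close> by simp
  qed
qed

lemma distribution_tendsto:
  fixes f :: "(real^'n \<Rightarrow> real) \<Rightarrow> real"
  assumes f: "distribution f" and \<phi>: "test_fun \<phi>" and \<Phi>: "\<And>n. test_fun (\<Phi> n)"
    and "bounded K" "support \<phi> \<subseteq> K" and supp: "\<forall>\<^sub>F n in F. support (\<Phi> n) \<subseteq> K"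
    and lim: "\<And>is. uniform_limit UNIV (\<lambda>n. pderivs is (\<Phi> n)) (pderivs is \<phi>) F"
  shows "((\<lambda>n. f (\<Phi> n)) \<longlongrightarrow> f \<phi>) F"
proof -
  define \<psi> where "\<psi> n = (\<lambda>x. \<Phi> n x - \<phi> x)" for n
  have \<psi>: "test_fun (\<psi> n)" for n
    unfolding \<psi>_def by (intro test_fun_diff \<phi> \<Phi>)
  have "compact (closure K)" using \<open>bounded K\<close> by simp
  then obtain C N where seminorm_bound: "\<And>\<phi>. test_fun \<phi> \<Longrightarrow> closure (support \<phi>) \<subseteq> closure K \<Longrightarrow>
      \<bar>f \<phi>\<bar> \<le> C * (\<Sum>is\<in>{is :: 'n list. length is \<le> N}. SUP x. \<bar>pderivs is \<phi> x\<bar>)"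
    using f unfolding distribution_def by meson
  define B where "B n = C * (\<Sum>is\<in>{is :: 'n list. length is \<le> N}. SUP x. \<bar>pderivs is (\<psi> n) x\<bar>)" for n
  have "uniform_limit UNIV (\<lambda>n x. pderivs is (\<Phi> n) x - pderivs is \<phi> x)
      (\<lambda>x. pderivs is \<phi> x - pderivs is \<phi> x) F" for "is"
    by (intro uniform_limit_intros lim)
  then have "uniform_limit UNIV (\<lambda>n. pderivs is (\<psi> n)) (\<lambda>_. 0) F" for "is"
    by (simp add: \<psi>_def pderivs_diff[OF \<Phi> \<phi>])
  then have "(B \<longlongrightarrow> 0) F"
    unfolding B_def by (intro tendsto_mult_right_zero tendsto_null_sum tendsto_SUP_abs_zero)
  moreover have "\<forall>\<^sub>F n in F. norm (f (\<psi> n)) \<le> B n"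
    using supp
  proof eventually_elim
    case (elim n)
    then have "\<Phi> n x = 0 \<and> \<phi> x = 0" if "x \<notin> K" for x
      using that \<open>support \<phi> \<subseteq> K\<close> by blast
    then have "\<psi> n x = 0" if "x \<notin> K" for x
      using that by (simp add: \<psi>_def)
    then have "support (\<psi> n) \<subseteq> K" by blast
    then show ?case using seminorm_bound[OF \<psi>] by (simp add: B_def closure_mono)
  qed
  ultimately have "((\<lambda>n. f (\<psi> n)) \<longlongrightarrow> 0) F"
    by (rule Lim_null_comparison[rotated])
  then show ?thesis
    by (simp add: \<psi>_def distribution_diff[OF f \<Phi> \<phi>] LIM_zero_iff)
qed

lemma distribution_translate_continuous:
  fixes f :: "(real^'n \<Rightarrow> real) \<Rightarrow> real"
  assumes f: "distribution f" and \<kappa>: "test_fun \<kappa>"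
  shows "continuous_on UNIV (\<lambda>y. f (\<lambda>x. \<kappa> (x - y)))"
  unfolding continuous_on_def
proof
  fix y
  have support_subset: "support (\<lambda>x. \<kappa> (x - z)) \<subseteq> cball y 1 + support \<kappa>" if "z \<in> cball y 1" for z
    using that by (auto intro: mem_set_plusI)
  show "((\<lambda>z. f (\<lambda>x. \<kappa> (x - z))) \<longlongrightarrow> f (\<lambda>x. \<kappa> (x - y))) (at y within UNIV)"
  proof (rule distribution_tendsto[OF f])
    show "bounded (cball y 1 + support \<kappa>)"
      by (intro bounded_set_plus bounded_cball test_fun_bounded_support \<kappa>)
    show "support (\<lambda>x. \<kappa> (x - y)) \<subseteq> cball y 1 + support \<kappa>"
      by (rule support_subset) simp
    have "\<forall>\<^sub>F z in at y. z \<in> cball y 1"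
      by (auto simp: eventually_at dist_commute intro!: exI[of _ 1])
    then show "\<forall>\<^sub>F z in at y. support (\<lambda>x. \<kappa> (x - z)) \<subseteq> cball y 1 + support \<kappa>"
      by eventually_elim (rule support_subset)
    show "uniform_limit UNIV (\<lambda>z. pderivs is (\<lambda>x. \<kappa> (x - z))) (pderivs is (\<lambda>x. \<kappa> (x - y))) (at y)"
      for "is"
      unfolding pderivs_translate[OF \<kappa>]
      by (intro uniform_limit_translates uniformly_continuous_on_bounded_support
          test_fun_continuous_pderivs test_fun_pderivs_bounded_support \<kappa>)
  qed (rule test_fun_translate[OF \<kappa>])+
qed

definition riemann_conv ::
    "('a::euclidean_space \<Rightarrow> real) \<Rightarrow> ('a \<Rightarrow> real) \<Rightarrow> ('a \<times> 'a set) set \<Rightarrow> 'a \<Rightarrow> real" where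
  "riemann_conv \<psi> \<kappa> p x = (\<Sum>(t, k)\<in>p. measure lborel k * \<psi> t * \<kappa> (x - t))"

lemma riemann_conv_eq_sum_translates:
  "riemann_conv \<psi> \<kappa> p = (\<lambda>x. \<Sum>z\<in>p. (measure lborel (snd z) * \<psi> (fst z)) * \<kappa> (x - fst z))"
  by (simp add: riemann_conv_def fun_eq_iff case_prod_beta')

lemma test_fun_riemann_conv: "test_fun \<kappa> \<Longrightarrow> test_fun (riemann_conv \<psi> \<kappa> p)"
  unfolding riemann_conv_eq_sum_translates by (rule test_fun_sum_translates)

lemma pderivs_riemann_conv:
  "smooth_fun \<kappa> \<Longrightarrow> pderivs is (riemann_conv \<psi> \<kappa> p) = riemann_conv \<psi> (pderivs is \<kappa>) p"
  unfolding riemann_conv_eq_sum_translates by (rule pderivs_sum_translates)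

lemma riemann_conv_support_subset:
  "support (riemann_conv \<psi> \<kappa> p) \<subseteq> support \<psi> + support \<kappa>"
proof
  fix x assume "x \<in> support (riemann_conv \<psi> \<kappa> p)"
  then obtain t where "\<psi> t \<noteq> 0" "\<kappa> (x - t) \<noteq> 0"
    by (auto simp: riemann_conv_eq_sum_translates elim!: sum.not_neutral_contains_not_neutral)
  then show "x \<in> support \<psi> + support \<kappa>"
    by (auto intro: mem_set_plusI)
qed

lemma uniform_limit_riemann_conv:
  fixes \<psi> \<eta> :: "'a::euclidean_space \<Rightarrow> real"
  assumes "continuous_on UNIV \<psi>" and supp: "support \<psi> \<subseteq> cbox a b"
    and \<eta>: "continuous_on UNIV \<eta>" "bounded (support \<eta>)"
  shows "uniform_limit UNIV (riemann_conv \<psi> \<eta>) (conv \<psi> \<eta>) (division_filter (cbox a b))"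
proof -
  define \<eta>t where "\<eta>t t = Bcontfun (\<lambda>x. \<eta> (x - t))" for t
  have \<eta>t: "apply_bcontfun (\<eta>t t) = (\<lambda>x. \<eta> (x - t))" for t
    unfolding \<eta>t_def
  proof (rule Bcontfun_inverse)
    have "bounded (range (\<lambda>x. \<eta> (x - t)))"
      by (rule bounded_subset[OF bounded_range_bounded_support[OF \<eta>]]) auto
    moreover have "continuous_on UNIV (\<lambda>x. \<eta> (x - t))"
      by (rule continuous_on_compose2[OF \<eta>(1)]) (auto intro!: continuous_intros)
    ultimately show "(\<lambda>x. \<eta> (x - t)) \<in> bcontfun"
      by (simp add: bcontfun_def)
  qed
  have "continuous_on UNIV \<eta>t"
    unfolding continuous_on_def
    using uniform_limit_translates[OF uniformly_continuous_on_bounded_support[OF \<eta>]]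
    by (intro ballI uniform_limit_tendsto_bcontfun) (simp add: \<eta>t)
  then have "continuous_on (cbox a b) (\<lambda>t. \<psi> t *\<^sub>R \<eta>t t)"
    using assms(1) by (auto intro: continuous_on_subset intro!: continuous_on_scaleR)
  from uniform_limit_riemann_sums[OF this] show ?thesis
    by (simp add: \<eta>t mult.assoc riemann_conv_def[abs_def] conv_eq_integral_cbox[OF supp])
qed

lemma distribution_riemann_conv:
  assumes "distribution f" "test_fun \<kappa>"
  shows "f (riemann_conv \<psi> \<kappa> p) = (\<Sum>(t, k)\<in>p. measure lborel k * (\<psi> t * f (\<lambda>x. \<kappa> (x - t))))"
  unfolding riemann_conv_eq_sum_translates
  by (subst distribution_sum[OF assms(1)])
    (auto simp: case_prod_beta' mult.assoc test_fun_translate assms(2))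

lemma distribution_conv:
  fixes f :: "(real^'n \<Rightarrow> real) \<Rightarrow> real"
  assumes f: "distribution f" and \<psi>: "continuous_on UNIV \<psi>" "bounded (support \<psi>)"
    and \<kappa>: "test_fun \<kappa>"
  shows "f (conv \<psi> \<kappa>) = integral UNIV (\<lambda>y. \<psi> y * f (\<lambda>x. \<kappa> (x - y)))"
proof -
  obtain a where a: "support \<psi> \<subseteq> cbox (- a) a"
    using bounded_subset_cbox_symmetric[OF \<psi>(2)] .
  have "((\<lambda>p. f (riemann_conv \<psi> \<kappa> p)) \<longlongrightarrow> f (conv \<psi> \<kappa>)) (division_filter (cbox (- a) a))"
  proof (rule distribution_tendsto[OF f test_fun_conv[OF \<psi> \<kappa>] test_fun_riemann_conv[OF \<kappa>]])
    show "bounded (support \<psi> + support \<kappa>)"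
      by (intro bounded_set_plus \<psi> test_fun_bounded_support \<kappa>)
    show "support (conv \<psi> \<kappa>) \<subseteq> support \<psi> + support \<kappa>"
      by (rule conv_support_subset)
    show "\<forall>\<^sub>F p in division_filter (cbox (- a) a).
        support (riemann_conv \<psi> \<kappa> p) \<subseteq> support \<psi> + support \<kappa>"
      by (intro always_eventually allI riemann_conv_support_subset)
    show "uniform_limit UNIV (\<lambda>p. pderivs is (riemann_conv \<psi> \<kappa> p)) (pderivs is (conv \<psi> \<kappa>))
        (division_filter (cbox (- a) a))" for "is"
      unfolding pderivs_conv[OF \<psi> test_fun_smooth[OF \<kappa>]]
        pderivs_riemann_conv[OF test_fun_smooth[OF \<kappa>]]
      by (intro uniform_limit_riemann_conv \<psi>(1) a test_fun_continuous_pderivs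
          test_fun_pderivs_bounded_support \<kappa>)
  qed
  moreover have "((\<lambda>p. f (riemann_conv \<psi> \<kappa> p)) \<longlongrightarrow> integral UNIV (\<lambda>y. \<psi> y * f (\<lambda>x. \<kappa> (x - y))))
      (division_filter (cbox (- a) a))"
  proof -
    have "continuous_on UNIV (\<lambda>y. \<psi> y * f (\<lambda>x. \<kappa> (x - y)))"
      by (intro continuous_on_mult \<psi>(1) distribution_translate_continuous f \<kappa>)
    moreover have "support (\<lambda>y. \<psi> y * f (\<lambda>x. \<kappa> (x - y))) \<subseteq> cbox (- a) a"
      using a by auto
    ultimately have "((\<lambda>y. \<psi> y * f (\<lambda>x. \<kappa> (x - y))) has_integral
        integral UNIV (\<lambda>y. \<psi> y * f (\<lambda>x. \<kappa> (x - y)))) (cbox (- a) a)"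
      by (rule has_integral_cbox_if_support_subset)
    then show ?thesis
      by (simp add: has_integral_cbox distribution_riemann_conv[OF f \<kappa>])
  qed
  ultimately show ?thesis
    by (rule tendsto_unique[OF division_filter_not_empty])
qed

section \<open>Distributional generalized polynomials\<close>

text \<open>Squaring a nonzero test function avoids the construction of a bump function.\<close>
lemma exists_test_fun_integral_nonzero:
  fixes \<phi> :: "real^'n \<Rightarrow> real"
  assumes \<phi>: "test_fun \<phi>" "\<phi> z \<noteq> 0"
  obtains \<rho> :: "real^'n \<Rightarrow> real" where "test_fun \<rho>" "integral UNIV \<rho> \<noteq> 0"
proof
  define \<rho> where "\<rho> x = \<phi> x * \<phi> x" for x
  show "test_fun \<rho>"
    unfolding \<rho>_def[abs_def] by (intro test_fun_mult \<phi>)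
  obtain a where a: "support \<rho> \<subseteq> cbox (- a) a"
    using bounded_subset_cbox_symmetric[OF test_fun_bounded_support[OF \<open>test_fun \<rho>\<close>]] .
  have "open (support \<rho>)"
    using test_fun_continuous[OF \<open>test_fun \<rho>\<close>] by (intro open_Collect_neq) auto
  then have "support \<rho> \<subseteq> box (- a) a"
    using interior_maximal[OF a] by (simp add: interior_cbox)
  then have z_mem: "z \<in> box (- a) a"
    using \<phi>(2) by (auto simp: \<rho>_def)
  have "continuous_on (cbox (- a) a) \<rho>"
    using test_fun_continuous[OF \<open>test_fun \<rho>\<close>] continuous_on_subset by blast
  then have "integral (cbox (- a) a) \<rho> \<noteq> 0"
    using integral_cbox_eq_0_iff[of "- a" a \<rho>] z_mem \<phi>(2) box_subset_cbox[of "- a" a]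
    by (auto simp: \<rho>_def)
  then show "integral UNIV \<rho> \<noteq> 0"
    by (simp add: integral_UNIV_eq_integral[OF a])
qed

lemma test_fun_mult_integrable:
  assumes "test_fun \<phi>" "continuous_on UNIV F"
  shows "(\<lambda>y. \<phi> y * F y) integrable_on UNIV"
proof (rule integrable_on_UNIV_if_bounded_support)
  show "continuous_on UNIV (\<lambda>y. \<phi> y * F y)"
    using assms by (simp add: continuous_on_mult test_fun_continuous)
  show "bounded (support (\<lambda>y. \<phi> y * F y))"
    by (intro bounded_support_mult test_fun_bounded_support assms(1))
qed

lemma integral_dilate_mult:
  fixes \<rho> F :: "'a::euclidean_space \<Rightarrow> real"
  assumes "continuous_on UNIV \<rho>" "bounded (support \<rho>)" "continuous_on UNIV F" "r > 0"
  shows "integral UNIV (\<lambda>y. \<rho> ((1 / r) *\<^sub>R y) * F y) =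
    r ^ DIM('a) * integral UNIV (\<lambda>y. \<rho> y * F (r *\<^sub>R y))"
proof -
  have "continuous_on UNIV (\<lambda>y. \<rho> y * F (r *\<^sub>R y))"
    by (intro continuous_intros assms(1) continuous_on_compose2[OF assms(3)]) auto
  moreover have "bounded (support (\<lambda>y. \<rho> y * F (r *\<^sub>R y)))"
    using assms(2) by (rule bounded_support_mult)
  ultimately show ?thesis
    using integral_UNIV_affine[of "\<lambda>y. \<rho> y * F (r *\<^sub>R y)" "1 / r" 0] assms(4)
    by (simp add: power_one_over)
qed

lemma integral_sum_dilates_mult:
  fixes \<rho> F :: "real^'n \<Rightarrow> real"
  assumes \<rho>: "test_fun \<rho>" and F: "continuous_on UNIV F"
  shows "integral UNIV (\<lambda>y. (\<Sum>k=1..N. c k * \<rho> ((1 / real k) *\<^sub>R y)) * F y) =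
    integral UNIV (\<lambda>y. \<rho> y * (\<Sum>k=1..N. c k * real k ^ CARD('n) * F (real k *\<^sub>R y)))"
proof -
  have "integral UNIV (\<lambda>y. (\<Sum>k=1..N. c k * \<rho> ((1 / real k) *\<^sub>R y)) * F y) =
      integral UNIV (\<lambda>y. \<Sum>k=1..N. c k * (\<rho> ((1 / real k) *\<^sub>R y) * F y))"
    by (simp add: sum_distrib_right mult.assoc)
  also have "\<dots> = (\<Sum>k=1..N. c k * integral UNIV (\<lambda>y. \<rho> ((1 / real k) *\<^sub>R y) * F y))"
  proof (subst integral_sum)
    show "(\<lambda>y. c k * (\<rho> ((1 / real k) *\<^sub>R y) * F y)) integrable_on UNIV" if "k \<in> {1..N}" for k
      using that
      by (intro integrable_on_mult_right test_fun_mult_integrable test_fun_dilate \<rho> F) simp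
  qed simp_all
  also have "\<dots> = (\<Sum>k=1..N. c k * real k ^ CARD('n) * integral UNIV (\<lambda>y. \<rho> y * F (real k *\<^sub>R y)))"
    using \<rho> F
    by (intro sum.cong)
      (auto simp: integral_dilate_mult test_fun_continuous test_fun_bounded_support)
  also have "\<dots> = integral UNIV (\<lambda>y. \<Sum>k=1..N. c k * real k ^ CARD('n) * (\<rho> y * F (real k *\<^sub>R y)))"
  proof (subst integral_sum)
    show "(\<lambda>y. c k * real k ^ CARD('n) * (\<rho> y * F (real k *\<^sub>R y))) integrable_on UNIV" for k
      by (intro integrable_on_mult_right test_fun_mult_integrable \<rho>
          continuous_on_compose2[OF F] continuous_intros) simp
  qed simp_all
  finally show ?thesis by (simp add: sum_distrib_left mult_ac)
qed

lemma generalized_polynomial_at_zero: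
  fixes F :: "'a::real_vector \<Rightarrow> real"
  assumes "generalized_polynomial N F"
  shows "F 0 = (\<Sum>k=1..N. (-1) ^ Suc k * real (N choose k) * F (real k *\<^sub>R y))"
proof -
  have "0 = (\<Sum>k\<le>N. (-1) ^ k * real (N choose k) * F (real k *\<^sub>R y))"
    using fdiff_funpow_binomial[of N y F 0]
      fun_cong[OF generalized_polynomialD[OF assms, of y], of 0] by simp
  also have "\<dots> = F 0 + (\<Sum>k=1..N. (-1) ^ k * real (N choose k) * F (real k *\<^sub>R y))"
    by (simp add: atMost_atLeast0 sum.atLeast_Suc_atMost)
  finally show ?thesis by (simp add: sum_negf)
qed

text \<open>The kernel comes from integrating the expression of \<open>F 0\<close> through the values \<open>F (k y)\<close>
  against \<open>\<rho> y\<close> and substituting \<open>y / k\<close> for \<open>y\<close>.\<close>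
lemma exists_reproducing_test_fun:
  fixes \<rho> :: "real^'n \<Rightarrow> real"
  assumes \<rho>: "test_fun \<rho>" "integral UNIV \<rho> \<noteq> 0"
  obtains \<kappa> :: "real^'n \<Rightarrow> real" where "test_fun \<kappa>" and "\<And>F. continuous_on UNIV F \<Longrightarrow>
    generalized_polynomial N F \<Longrightarrow> integral UNIV (\<lambda>y. \<kappa> y * F y) = F 0"
proof -
  define m where "m = integral UNIV \<rho>"
  define w where "w k = (-1) ^ Suc k * real (N choose k)" for k
  define \<kappa> where "\<kappa> y = (\<Sum>k=1..N. w k / (m * real k ^ CARD('n)) * \<rho> ((1 / real k) *\<^sub>R y))" for y
  have "test_fun \<kappa>"
    unfolding \<kappa>_def[abs_def] by (rule test_fun_sum) (simp add: test_fun_dilate \<rho>(1))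
  moreover have "integral UNIV (\<lambda>y. \<kappa> y * F y) = F 0"
    if F: "continuous_on UNIV F" and gen: "generalized_polynomial N F" for F
  proof -
    have at_zero: "(\<Sum>k=1..N. w k / (m * real k ^ CARD('n)) * real k ^ CARD('n) * F (real k *\<^sub>R y)) =
        F 0 / m" for y
      unfolding generalized_polynomial_at_zero[OF gen, of y] sum_divide_distrib
      by (rule sum.cong) (auto simp: w_def)
    have "integral UNIV (\<lambda>y. \<kappa> y * F y) = integral UNIV (\<lambda>y. \<rho> y * (F 0 / m))"
      unfolding \<kappa>_def integral_sum_dilates_mult[OF \<rho>(1) F] at_zero ..
    also have "\<dots> = F 0"
      using \<rho>(2) by (simp add: m_def)
    finally show ?thesis .
  qed
  ultimately show thesis by (rule that)
qed

theorem distribution_generalized_polynomial_imp_poly_distribution: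
  fixes f :: "(real^'n \<Rightarrow> real) \<Rightarrow> real"
  assumes f: "distribution f"
    and gen: "\<And>\<psi>. test_fun \<psi> \<Longrightarrow> generalized_polynomial N (\<lambda>y. f (\<lambda>x. \<psi> (x - y)))"
  shows "poly_distribution f"
proof (cases "\<exists>\<phi> :: real^'n \<Rightarrow> real. test_fun \<phi> \<and> \<phi> \<noteq> (\<lambda>_. 0)")
  case False
  then have "\<forall>\<phi>. test_fun \<phi> \<longrightarrow> f \<phi> = integral UNIV (\<lambda>x. 0 * \<phi> x)"
    using distribution_zero[OF f] by auto
  then show ?thesis
    unfolding poly_distribution_def using is_polynomial_const by blast
next
  case True
  then obtain \<phi> :: "real^'n \<Rightarrow> real" and z where "test_fun \<phi>" "\<phi> z \<noteq> 0" by fastforce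
  then obtain \<rho> :: "real^'n \<Rightarrow> real" where "test_fun \<rho>" "integral UNIV \<rho> \<noteq> 0"
    by (rule exists_test_fun_integral_nonzero)
  then obtain \<kappa> :: "real^'n \<Rightarrow> real" where \<kappa>: "test_fun \<kappa>"
    and reproducing: "\<And>F. continuous_on UNIV F \<Longrightarrow>
      generalized_polynomial N F \<Longrightarrow> integral UNIV (\<lambda>y. \<kappa> y * F y) = F 0"
    by (rule exists_reproducing_test_fun[where N = N]) (rule that)
  define p where "p y = f (\<lambda>x. \<kappa> (x - y))" for y
  have "is_polynomial p"
    unfolding p_def[abs_def]
    by (rule continuous_generalized_polynomial_imp_is_polynomial[OF
          distribution_translate_continuous[OF f \<kappa>] gen[OF \<kappa>]])
  moreover have "f \<psi> = integral UNIV (\<lambda>x. p x * \<psi> x)" if \<psi>: "test_fun \<psi>" for \<psi>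
  proof -
    have "f \<psi> = integral UNIV (\<lambda>y. \<kappa> y * f (\<lambda>x. \<psi> (x - y)))"
      using reproducing[OF distribution_translate_continuous[OF f \<psi>] gen[OF \<psi>]] by simp
    also have "\<dots> = f (conv \<kappa> \<psi>)"
      by (intro distribution_conv[symmetric] f \<psi> \<kappa> test_fun_continuous test_fun_bounded_support)
    also have "conv \<kappa> \<psi> = conv \<psi> \<kappa>"
      by (intro conv_commute \<psi> \<kappa> test_fun_continuous test_fun_bounded_support)
    also have "f \<dots> = integral UNIV (\<lambda>x. \<psi> x * p x)"
      unfolding p_def
      by (intro distribution_conv f \<psi> \<kappa> test_fun_continuous test_fun_bounded_support)
    finally show ?thesis by (simp add: mult.commute)
  qed
  ultimately show ?thesis unfolding poly_distribution_def by blast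
qed

section \<open>Invariant spaces of functions and distributions\<close>

lemma invariant_continuous_imp_is_polynomial:
  fixes G :: "(real^'n^'n) set" and V :: "(real^'n \<Rightarrow> real) set"
  assumes G: "subgroup_GL G" and int: "interior (Lambda_set G z0) \<noteq> {}"
    and cont: "V \<subseteq> {g. continuous_on UNIV g}" and fin: "fin_dim_subspace V"
    and tau: "\<forall>h. tau_C h ` V \<subseteq> V" and O: "\<forall>P\<in>G. O_C P ` V \<subseteq> V" and g: "g \<in> V"
  shows "is_polynomial g"
proof -
  interpret equivariant_translations G z0 V tau_C O_C
  proof
    show "linear_endo_on V (tau_C h)" for h
      using tau by (auto simp: linear_endo_on_def tau_C_def)
    show "linear_endo_on V (O_C P)" if "P \<in> G" for P
      using O that by (auto simp: linear_endo_on_def O_C_def)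
    show "O_C (matrix_inv P) (O_C P g) = g" if "P \<in> G" for P g
      using G that
      by (simp add: subgroup_GL_def O_C_def matrix_vector_mul_assoc invertible_matrix_inv)
  qed (use G int fin in \<open>simp_all add: tau_C_def O_C_def matrix_vector_right_distrib add_ac\<close>)
  obtain N where "generalized_polynomial N (\<lambda>y. tau_C y g 0)"
    using orbits_generalized_polynomial g by blast
  then have "generalized_polynomial N g" by (simp add: tau_C_def)
  then show ?thesis
    using continuous_generalized_polynomial_imp_is_polynomial cont g by blast
qed

lemma O_D_tau_D:
  assumes "invertible P"
  shows "O_D P (tau_D (P *v h) f) = tau_D h (O_D P f)"
proof
  fix \<phi>
  note inv = invertible_matrix_inv[OF assms]
  have "invertible (matrix_inv P)" using inv by (auto simp: invertible_def)
  moreover have "matrix_inv P *v (x - P *v h) = matrix_inv P *v x - h" for x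
    by (simp add: matrix_vector_mult_diff_distrib matrix_vector_mul_assoc inv)
  ultimately show "O_D P (tau_D (P *v h) f) \<phi> = tau_D h (O_D P f) \<phi>"
    by (simp add: O_D_def tau_D_def test_fun_matrix test_fun_translate)
qed

lemma O_D_matrix_inv_O_D:
  assumes "invertible P" and "distribution f"
  shows "O_D (matrix_inv P) (O_D P f) = f"
proof
  fix \<phi>
  note inv = invertible_matrix_inv[OF assms(1)]
  have "\<bar>det P\<bar> * \<bar>det (matrix_inv P)\<bar> = 1"
    using inv(1) by (metis abs_mult abs_one det_I det_mul)
  moreover have "f \<phi> = 0" if "\<not> test_fun \<phi>"
    using assms(2) that by (auto simp: distribution_def)
  ultimately show "O_D (matrix_inv P) (O_D P f) \<phi> = f \<phi>"
    by (simp add: O_D_def matrix_inv_matrix_inv[OF assms(1)] test_fun_matrix[OF _ assms(1)]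
        matrix_vector_mul_assoc inv)
qed

lemma invariant_distribution_imp_poly_distribution:
  fixes G :: "(real^'n^'n) set" and V :: "((real^'n \<Rightarrow> real) \<Rightarrow> real) set"
  assumes G: "subgroup_GL G" and int: "interior (Lambda_set G z0) \<noteq> {}"
    and dist: "V \<subseteq> {f. distribution f}" and fin: "fin_dim_subspace V"
    and tau: "\<forall>h. tau_D h ` V \<subseteq> V" and O: "\<forall>P\<in>G. O_D P ` V \<subseteq> V" and f: "f \<in> V"
  shows "poly_distribution f"
proof -
  have inv: "invertible P" if "P \<in> G" for P
    using that G by (simp add: subgroup_GL_def)
  interpret equivariant_translations G z0 V tau_D O_D
  proof
    show "linear_endo_on V (tau_D h)" for h
      using tau by (auto simp: linear_endo_on_def tau_D_def)
    show "linear_endo_on V (O_D P)" if "P \<in> G" for P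
      using O that by (auto simp: linear_endo_on_def O_D_def add_divide_distrib)
    show "tau_D h (tau_D k f) = tau_D (h + k) f" for h k f
      by (auto simp: tau_D_def test_fun_translate algebra_simps)
    show "O_D P (tau_D (P *v h) f) = tau_D h (O_D P f)" if "P \<in> G" for P h f
      using inv[OF that] by (rule O_D_tau_D)
    show "O_D (matrix_inv P) (O_D P f) = f" if "P \<in> G" "f \<in> V" for P f
      using dist inv that by (auto intro: O_D_matrix_inv_O_D)
  qed (use G int fin in auto)
  obtain N where N: "\<And>\<psi>. generalized_polynomial N (\<lambda>y. tau_D y f \<psi>)"
    using orbits_generalized_polynomial f by blast
  have "distribution f" using dist f by auto
  then show ?thesis
  proof (rule distribution_generalized_polynomial_imp_poly_distribution)
    show "generalized_polynomial N (\<lambda>y. f (\<lambda>x. \<psi> (x - y)))" if "test_fun \<psi>" for \<psi>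
      using N[of \<psi>] that by (simp add: tau_D_def)
  qed
qed

theorem mainTheorem2:
  fixes G :: "(real^'n^'n) set" and z0 :: "real^'n"
  assumes "subgroup_GL G"
    and "interior (Lambda_set G z0) \<noteq> {}"
  shows "(\<forall>V :: (real^'n \<Rightarrow> real) set.
            V \<subseteq> {g. continuous_on UNIV g} \<and> fin_dim_subspace V \<and>
            (\<forall>h. tau_C h ` V \<subseteq> V) \<and> (\<forall>P\<in>G. O_C P ` V \<subseteq> V)
            \<longrightarrow> (\<forall>g\<in>V. is_polynomial g))
       \<and> (\<forall>V :: ((real^'n \<Rightarrow> real) \<Rightarrow> real) set.
            V \<subseteq> {f. distribution f} \<and> fin_dim_subspace V \<and>
            (\<forall>h. tau_D h ` V \<subseteq> V) \<and> (\<forall>P\<in>G. O_D P ` V \<subseteq> V)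
            \<longrightarrow> (\<forall>f\<in>V. poly_distribution f))"
  using invariant_continuous_imp_is_polynomial[OF assms]
    invariant_distribution_imp_poly_distribution[OF assms] by blast

end
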